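(* Let $u$ be a finite game whose response graph is strongly connected. Then every mixed profile $x\in X$ is chain recurrent under the replicator flow of $u$.
   Context: Games. A (finite) game has players $1,\dots,N$, finite non-empty strategy sets $S_1,\dots,S_N$ and a utility function $u:Z\to\mathbb{R}^N$, where $Z=\prod_{i=1}^N S_i$ is the set of (pure) profiles. Two profiles are $i$-comparable if they differ exactly in the strategy of player $i$. The response graph is the directed graph with node set $Z$ and an arc $p\to q$ if and only if $p,q$ are $i$-comparable for some $i$ and $u_i(p)\le u_i(q)$. The strategy space is $X=\prod_{i=1}^N\Delta_{|S_i|}$, where $\Delta_{|S_i|}$ is the simplex of probability distributions on $S_i$; its elements are mixed profiles. For $x\in X$, $x^i_s$ is the probability player $i$ gives to $s\in S_i$. The expected utility is $\mathbb{U}(x)=\sum_{q\in Z}u(q)\prod_{i=1}^N x^i_{q_i}$, and $\mathbb{U}_p(s;\bar x_{-p})$ denotes player $p$'s expected utility when $p$ plays $s$ and the others play according to $x$. Replicator flow. The replicator flow $\phi:X\times\mathbb{R}\to X$ is the flow of the ODE $\dot x^p_s=x^p_s\bigl(\mathbb{U}_p(s;\bar x_{-p})-\sum_{t\in S_p}x^p_t\,\mathbb{U}_p(t;\bar x_{-p})\bigr)$. Chains. Let $\mathbf{d}$ be the Euclidean metric on $X$. For $\epsilon,T>0$, an $(\epsilon,T)$-chain from $x$ to $y$ is a finite sequence $x=x_1,x_2,\dots,x_n=y$ with $n\ge 2$ and times $t_1,\dots,t_{n-1}\ge T$ such that $\mathbf{d}(\phi(x_i,t_i),x_{i+1})<\epsilon$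 for $1\le i\le n-1$. There is a pseudo-orbit from $x$ to $y$ if there is an $(\epsilon,T)$-chain from $x$ to $y$ for all $\epsilon>0$ and $T>0$. A point $x$ is chain recurrent if there is a pseudo-orbit from $x$ to itself. *)

theory Defs
  imports "HOL-Analysis.Analysis" "Graph_Theory.Digraph_Component"
begin

text \<open>
  A game is given by strategy sets \<open>S i\<close> inside one finite type \<open>'s\<close>, for the players \<open>i\<close> of a
  finite type \<open>'n\<close>, and a utility function \<open>u\<close>. Only the values of \<open>u\<close> on \<open>profiles S\<close> matter.
\<close>

definition profiles :: "('n \<Rightarrow> 's set) \<Rightarrow> ('n \<Rightarrow> 's) set"
  where "profiles S = {p. \<forall>i. p i \<in> S i}"

definition comparable :: "'n \<Rightarrow> ('n \<Rightarrow> 's) \<Rightarrow> ('n \<Rightarrow> 's) \<Rightarrow> bool"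
  where "comparable i p q \<longleftrightarrow> p i \<noteq> q i \<and> (\<forall>j. j \<noteq> i \<longrightarrow> p j = q j)"

definition response_graph ::
  "('n::finite \<Rightarrow> 's set) \<Rightarrow> (('n \<Rightarrow> 's) \<Rightarrow> real ^ 'n)
    \<Rightarrow> ('n \<Rightarrow> 's, ('n \<Rightarrow> 's) \<times> ('n \<Rightarrow> 's)) pre_digraph"
  where "response_graph S u =
    \<lparr> verts = profiles S,
      arcs = {(p, q). p \<in> profiles S \<and> q \<in> profiles S \<and> (\<exists>i. comparable i p q \<and> u p $ i \<le> u q $ i)},
      tail = fst,
      head = snd \<rparr>"

text \<open>
  A mixed profile \<open>x\<close> has \<open>x $ i $ s\<close> as the probability that player \<open>i\<close> gives to \<open>s\<close>; coordinates
  outside \<open>S i\<close> are zero, so \<^const>\<open>dist\<close> on this type restricts to the Euclidean metric of the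
  product of simplices.
\<close>

definition mixed_profiles :: "('n::finite \<Rightarrow> 's::finite set) \<Rightarrow> (real ^ 's ^ 'n) set"
  where "mixed_profiles S =
    {x. \<forall>i. (\<forall>s. 0 \<le> x $ i $ s) \<and> (\<forall>s. s \<notin> S i \<longrightarrow> x $ i $ s = 0) \<and> (\<Sum>s\<in>S i. x $ i $ s) = 1}"

definition expected_utility ::
  "('n::finite \<Rightarrow> 's::finite set) \<Rightarrow> (('n \<Rightarrow> 's) \<Rightarrow> real ^ 'n) \<Rightarrow> real ^ 's ^ 'n \<Rightarrow> real ^ 'n"
  where "expected_utility S u x = (\<Sum>q\<in>profiles S. (\<Prod>i\<in>UNIV. x $ i $ q i) *\<^sub>R u q)"

definition strategy_utility ::
  "('n::finite \<Rightarrow> 's::finite set) \<Rightarrow> (('n \<Rightarrow> 's) \<Rightarrow> real ^ 'n)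
    \<Rightarrow> 'n \<Rightarrow> 's \<Rightarrow> real ^ 's ^ 'n \<Rightarrow> real"
  where "strategy_utility S u p s x =
    expected_utility S u (\<chi> i. if i = p then axis s 1 else x $ i) $ p"

definition replicator_field ::
  "('n::finite \<Rightarrow> 's::finite set) \<Rightarrow> (('n \<Rightarrow> 's) \<Rightarrow> real ^ 'n) \<Rightarrow> real ^ 's ^ 'n \<Rightarrow> real ^ 's ^ 'n"
  where "replicator_field S u x =
    (\<chi> p s. x $ p $ s *
      (strategy_utility S u p s x - (\<Sum>t\<in>S p. x $ p $ t * strategy_utility S u p t x)))"

definition is_flow_of ::
  "('a::real_normed_vector \<Rightarrow> 'a) \<Rightarrow> 'a set \<Rightarrow> ('a \<Rightarrow> real \<Rightarrow> 'a) \<Rightarrow> bool"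
  where "is_flow_of F X \<phi> \<longleftrightarrow>
    (\<forall>x\<in>X. \<phi> x 0 = x \<and>
      (\<forall>t. \<phi> x t \<in> X \<and> (\<phi> x has_vector_derivative F (\<phi> x t)) (at t)))"

text \<open>
  The replicator field is Lipschitz on the compact set \<open>mixed_profiles S\<close>, which its solutions never
  leave, so the following predicate holds for exactly one \<open>\<phi>\<close> up to values outside that set.
\<close>

definition is_replicator_flow ::
  "('n::finite \<Rightarrow> 's::finite set) \<Rightarrow> (('n \<Rightarrow> 's) \<Rightarrow> real ^ 'n)
    \<Rightarrow> (real ^ 's ^ 'n \<Rightarrow> real \<Rightarrow> real ^ 's ^ 'n) \<Rightarrow> bool"
  where "is_replicator_flow S u \<phi> \<longleftrightarrow> is_flow_of (replicator_field S u) (mixed_profiles S) \<phi>"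

definition has_chain ::
  "'a::metric_space set \<Rightarrow> ('a \<Rightarrow> real \<Rightarrow> 'a) \<Rightarrow> real \<Rightarrow> real \<Rightarrow> 'a \<Rightarrow> 'a \<Rightarrow> bool"
  where "has_chain X \<phi> \<epsilon> T x y \<longleftrightarrow>
    (\<exists>n\<ge>2. \<exists>(c :: nat \<Rightarrow> 'a) (t :: nat \<Rightarrow> real).
      c 1 = x \<and> c n = y \<and> (\<forall>i\<in>{1..n}. c i \<in> X) \<and>
      (\<forall>i\<in>{1..n - 1}. t i \<ge> T \<and> dist (\<phi> (c i) (t i)) (c (i + 1)) < \<epsilon>))"

definition has_pseudo_orbit ::
  "'a::metric_space set \<Rightarrow> ('a \<Rightarrow> real \<Rightarrow> 'a) \<Rightarrow> 'a \<Rightarrow> 'a \<Rightarrow> bool"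
  where "has_pseudo_orbit X \<phi> x y \<longleftrightarrow> (\<forall>\<epsilon>>0. \<forall>T>0. has_chain X \<phi> \<epsilon> T x y)"

definition chain_recurrent :: "'a::metric_space set \<Rightarrow> ('a \<Rightarrow> real \<Rightarrow> 'a) \<Rightarrow> 'a \<Rightarrow> bool"
  where "chain_recurrent X \<phi> x \<longleftrightarrow> has_pseudo_orbit X \<phi> x x"

end

theory Submission
  imports Defs
begin

text \<open>
  It suffices to connect every mixed profile to a pure one in both directions, since pure profiles
  are connected along the arcs of the response graph: on the edge between two comparable pure
  profiles the flow moves monotonically towards the better reply. Reversing time replaces \<open>u\<close> by
  \<open>-u\<close>, so only one direction has to be shown.

  To get from a mixed profile \<open>x\<close> to a smaller face, pass to logit coordinates on the face of \<open>x\<close>.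
  There the velocity of each player depends only on the other players, so moving the players one
  after the other is a composition of shears, which after rounding becomes an injective self-map of
  a fine lattice that approximates the flow. Since chains may also make a small jump in one lattice
  direction, the set of reachable lattice points cannot be finite; hence it is unbounded in logit
  coordinates, which means that it comes arbitrarily close to the boundary of the face.
\<close>

section \<open>Integral curves of Lipschitz fields\<close>

text \<open>Behind the lattice stands volume preservation. In logits the replicator flow on the
  interior of a face is divergence free, so no bounded region can be carried strictly into itself.
  Counting lattice points replaces measure: an injection of a finite set plays the role of a
  volume-preserving map, and a single extra jump plays the role of strict inclusion.

  Rounding the flow map directly could identify lattice points. Splitting the field by players
  avoids this, because rounding the displacement of a shear leaves it a shear.

  The errors must be uniform over a region that is unbounded in logits. They are therefore measured
  in the Euclidean metric, where changing logits by at most \<delta> moves a point by at most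
  \<open>mesh\<close>, however close to the boundary it lies. With \<delta> chosen so that
  \<open>mesh\<close> equals h^2, one sweep over the players has error O(h^2), and the T/h sweeps
  that make up a flow of time T have error O(h). The final jump to the boundary costs only the mass
  of the strategy that is dropped.\<close>

definition lipschitz_field :: "('a::real_inner \<Rightarrow> 'a) \<Rightarrow> 'a set \<Rightarrow> real \<Rightarrow> bool"
  where "lipschitz_field F X L \<longleftrightarrow> 0 \<le> L \<and> (\<forall>x\<in>X. \<forall>y\<in>X. norm (F x - F y) \<le> L * norm (x - y))"

definition integral_curve :: "('a::real_normed_vector \<Rightarrow> 'a) \<Rightarrow> 'a set \<Rightarrow> (real \<Rightarrow> 'a) \<Rightarrow> bool"
  where "integral_curve F X z \<longleftrightarrow> (\<forall>t. z t \<in> X \<and> (z has_vector_derivative F (z t)) (at t))"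

lemma is_flow_of_iff:
  "is_flow_of F X \<phi> \<longleftrightarrow> (\<forall>x\<in>X. \<phi> x 0 = x \<and> integral_curve F X (\<phi> x))"
  by (auto simp: is_flow_of_def integral_curve_def)

lemma integral_curve_in: "integral_curve F X z \<Longrightarrow> z t \<in> X"
  by (simp add: integral_curve_def)

lemma integral_curve_deriv:
  "integral_curve F X z \<Longrightarrow> (z has_vector_derivative F (z t)) (at t)"
  by (simp add: integral_curve_def)

lemma integral_curve_shift:
  assumes "integral_curve F X z"
  shows "integral_curve F X (\<lambda>t. z (s + t))"
proof -
  have "((\<lambda>t. z (s + t)) has_vector_derivative F (z (s + t))) (at t)" for t
  proof -
    have "((\<lambda>t. s + t) has_vector_derivative 1) (at t)"
      by (auto intro!: derivative_eq_intros)
    from vector_diff_chain_at[OF this integral_curve_deriv[OF assms]]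
    show ?thesis by (simp add: o_def)
  qed
  then show ?thesis using assms by (simp add: integral_curve_def)
qed

lemma integral_curve_reverse:
  assumes "integral_curve F X z"
  shows "integral_curve (\<lambda>x. - F x) X (\<lambda>t. z (- t))"
proof -
  have "((\<lambda>t. z (- t)) has_vector_derivative - F (z (- t))) (at t)" for t
  proof -
    have "((\<lambda>t::real. - t) has_vector_derivative - 1) (at t)"
      by (auto intro!: derivative_eq_intros)
    from vector_diff_chain_at[OF this integral_curve_deriv[OF assms]]
    show ?thesis by (simp add: o_def)
  qed
  then show ?thesis using assms by (simp add: integral_curve_def)
qed

lemma lipschitz_field_minus:
  "lipschitz_field F X L \<Longrightarrow> lipschitz_field (\<lambda>x. - F x) X L"
  unfolding lipschitz_field_def by (metis minus_diff_minus norm_minus_cancel)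

text \<open>Gronwall in differential form: by Cauchy-Schwarz the squared distance grows at rate at
  most 2L, so \<open>g\<close>, the squared distance damped by \<open>exp (- (2 * L * s))\<close>,
  is nonincreasing.\<close>

lemma integral_curves_dist_le:
  fixes F :: "'a::real_inner \<Rightarrow> 'a"
  assumes lip: "lipschitz_field F X L"
    and z: "integral_curve F X z" and w: "integral_curve F X w" and t: "0 \<le> t"
  shows "dist (z t) (w t) \<le> exp (L * t) * dist (z 0) (w 0)"
proof -
  define g where "g s = exp (- (2 * L * s)) * ((z s - w s) \<bullet> (z s - w s))" for s
  have "\<exists>y. (g has_real_derivative y) (at s) \<and> y \<le> 0" for s
  proof -
    let ?d = "z s - w s" and ?e = "F (z s) - F (w s)"
    have d: "((\<lambda>s. z s - w s) has_vector_derivative ?e) (at s)"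
      by (intro has_vector_derivative_diff integral_curve_deriv[OF z] integral_curve_deriv[OF w])
    have "((\<lambda>s. (z s - w s) \<bullet> (z s - w s)) has_derivative (\<lambda>h. ?d \<bullet> (h *\<^sub>R ?e) + (h *\<^sub>R ?e) \<bullet> ?d)) (at s)"
      by (rule has_derivative_inner[OF d[unfolded has_vector_derivative_def] d[unfolded has_vector_derivative_def]])
    moreover have "(\<lambda>h. ?d \<bullet> (h *\<^sub>R ?e) + (h *\<^sub>R ?e) \<bullet> ?d) = (*) (2 * (?d \<bullet> ?e))"
      by (auto simp: inner_commute)
    ultimately have dd: "((\<lambda>s. (z s - w s) \<bullet> (z s - w s)) has_real_derivative 2 * (?d \<bullet> ?e)) (at s)"
      by (simp add: has_field_derivative_def)
    have dg: "(g has_real_derivative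
        exp (- (2 * L * s)) * (2 * (?d \<bullet> ?e) - 2 * L * (?d \<bullet> ?d))) (at s)"
      unfolding g_def by (rule derivative_eq_intros dd refl)+ (simp add: algebra_simps)
    have "?d \<bullet> ?e \<le> norm ?d * norm ?e" by (rule norm_cauchy_schwarz)
    also have "\<dots> \<le> norm ?d * (L * norm ?d)"
      using lip integral_curve_in[OF z] integral_curve_in[OF w]
      by (intro mult_left_mono) (auto simp: lipschitz_field_def)
    also have "\<dots> = L * (?d \<bullet> ?d)" by (simp add: dot_square_norm power2_eq_square)
    finally have "exp (- (2 * L * s)) * (2 * (?d \<bullet> ?e) - 2 * L * (?d \<bullet> ?d)) \<le> 0"
      by (intro mult_nonneg_nonpos) auto
    with dg show ?thesis by blast
  qed
  then have "g t \<le> g 0" by (intro DERIV_nonpos_imp_nonincreasing[OF t]) auto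
  then have "exp (- (2 * L * t)) * (norm (z t - w t))\<^sup>2 \<le> (norm (z 0 - w 0))\<^sup>2"
    by (simp add: g_def dot_square_norm)
  then have "(norm (z t - w t))\<^sup>2 \<le> exp (2 * L * t) * (norm (z 0 - w 0))\<^sup>2"
    by (simp add: exp_minus field_simps)
  also have "\<dots> = (exp (L * t) * norm (z 0 - w 0))\<^sup>2"
    by (simp add: power_mult_distrib power2_eq_square[of "exp _"] flip: exp_add)
  finally show ?thesis unfolding dist_norm by (rule power2_le_imp_le) simp
qed

text \<open>The flow is given only through a predicate, so uniqueness is what yields its group law
  and, later, its closed form on an edge.\<close>

lemma integral_curve_unique:
  fixes F :: "'a::real_inner \<Rightarrow> 'a"
  assumes lip: "lipschitz_field F X L"
    and z: "integral_curve F X z" and w: "integral_curve F X w" and eq: "z 0 = w 0"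
  shows "z t = w t"
proof (cases "0 \<le> t")
  case True
  then show ?thesis using integral_curves_dist_le[OF lip z w] eq by fastforce
next
  case False
  then show ?thesis
    using integral_curves_dist_le[OF lipschitz_field_minus[OF lip] integral_curve_reverse[OF z]
        integral_curve_reverse[OF w], of "- t"] eq by simp
qed

lemma flow_add:
  fixes F :: "'a::real_inner \<Rightarrow> 'a"
  assumes lip: "lipschitz_field F X L" and fl: "is_flow_of F X \<phi>" and x: "x \<in> X"
  shows "\<phi> (\<phi> x s) t = \<phi> x (s + t)"
proof (rule integral_curve_unique[OF lip, where z = "\<phi> (\<phi> x s)" and w = "\<lambda>t. \<phi> x (s + t)"])
  have c: "integral_curve F X (\<phi> x)" using fl x by (simp add: is_flow_of_iff)
  then have "\<phi> x s \<in> X" by (rule integral_curve_in)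
  then show "integral_curve F X (\<phi> (\<phi> x s))" "\<phi> (\<phi> x s) 0 = \<phi> x (s + 0)"
    using fl by (auto simp: is_flow_of_iff)
  show "integral_curve F X (\<lambda>t. \<phi> x (s + t))" by (rule integral_curve_shift[OF c])
qed

lemma flow_reverse:
  "is_flow_of F X \<phi> \<Longrightarrow> is_flow_of (\<lambda>x. - F x) X (\<lambda>x t. \<phi> x (- t))"
  unfolding is_flow_of_iff using integral_curve_reverse by fastforce

section \<open>Quantitative bounds: displacement, Euler step, accumulated error\<close>

lemma curve_dist_le:
  fixes z :: "real \<Rightarrow> 'a::real_normed_vector"
  assumes "\<And>s. 0 \<le> s \<Longrightarrow> s \<le> h \<Longrightarrow> (z has_vector_derivative z' s) (at s)"
    and "\<And>s. 0 \<le> s \<Longrightarrow> s \<le> h \<Longrightarrow> norm (z' s) \<le> M" and "0 \<le> h"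
  shows "norm (z h - z 0) \<le> M * h"
proof -
  have "norm (z h - z 0) \<le> M * norm (h - 0)"
  proof (rule differentiable_bound[of "{0..h}"])
    show "(z has_derivative (\<lambda>r. r *\<^sub>R z' s)) (at s within {0..h})" if "s \<in> {0..h}" for s
      using assms(1)[of s] that unfolding has_vector_derivative_def
      by (auto intro: has_derivative_at_withinI)
    show "onorm (\<lambda>r. r *\<^sub>R z' s) \<le> M" if "s \<in> {0..h}" for s
      using assms(2)[of s] that by (intro onorm_le) (auto simp: mult.commute[of M] intro!: mult_left_mono)
  qed (use assms(3) in auto)
  then show ?thesis using assms(3) by simp
qed

lemma integral_curve_dist_le:
  assumes z: "integral_curve F X z" and bd: "\<And>x. x \<in> X \<Longrightarrow> norm (F x) \<le> M" and h: "0 \<le> h"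
  shows "norm (z h - z 0) \<le> M * h"
  using integral_curve_deriv[OF z] bd integral_curve_in[OF z] h
  by (intro curve_dist_le[where z' = "\<lambda>s. F (z s)"]) auto

text \<open>Up to time h the curve moves by at most M h, so its velocity deviates from
  \<open>F (z 0)\<close> by at most L M h. The mean value bound is applied to the curve minus its
  tangent line.\<close>

lemma integral_curve_euler_error:
  assumes lip: "lipschitz_field F X L" and z: "integral_curve F X z"
    and bd: "\<And>x. x \<in> X \<Longrightarrow> norm (F x) \<le> M" and h: "0 \<le> h"
  shows "norm (z h - z 0 - h *\<^sub>R F (z 0)) \<le> L * M * h\<^sup>2"
proof -
  have L: "0 \<le> L" using lip by (simp add: lipschitz_field_def)
  have M: "0 \<le> M" using bd[OF integral_curve_in[OF z, of 0]] norm_ge_zero order_trans by blast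
  have "norm ((z h - h *\<^sub>R F (z 0)) - (z 0 - 0 *\<^sub>R F (z 0))) \<le> (L * (M * h)) * h"
  proof (rule curve_dist_le[where z' = "\<lambda>s. F (z s) - F (z 0)"])
    fix s assume s: "0 \<le> s" "s \<le> h"
    show "((\<lambda>s. z s - s *\<^sub>R F (z 0)) has_vector_derivative F (z s) - F (z 0)) (at s)"
      by (rule derivative_eq_intros integral_curve_deriv[OF z] refl)+ simp
    have "norm (F (z s) - F (z 0)) \<le> L * norm (z s - z 0)"
      using lip integral_curve_in[OF z] by (auto simp: lipschitz_field_def)
    also have "\<dots> \<le> L * (M * s)"
      by (intro mult_left_mono integral_curve_dist_le[OF z bd] s L)
    also have "\<dots> \<le> L * (M * h)"
      by (intro mult_left_mono s L M)
    finally show "norm (F (z s) - F (z 0)) \<le> L * (M * h)" .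
  qed (rule h)
  then show ?thesis by (simp add: power2_eq_square algebra_simps)
qed

lemma flow_dist_le:
  fixes F :: "'a::real_inner \<Rightarrow> 'a"
  assumes "lipschitz_field F X L" "is_flow_of F X \<phi>" "x \<in> X" "y \<in> X" "0 \<le> t"
  shows "dist (\<phi> x t) (\<phi> y t) \<le> exp (L * t) * dist x y"
  using integral_curves_dist_le[OF assms(1), of "\<phi> x" "\<phi> y" t] assms by (simp add: is_flow_of_iff)

text \<open>The usual passage from local to global error. The approximate map \<Psi> acts on labels
  \<open>k\<close>, which \<open>e\<close> places in the space; the labels will be lattice
  points.\<close>

lemma one_step_method_error:
  fixes F :: "'a::real_inner \<Rightarrow> 'a"
  assumes lip: "lipschitz_field F X L" and fl: "is_flow_of F X \<phi>"
    and e: "\<And>k. e k \<in> X" and loc: "\<And>k. dist (\<phi> (e k) h) (e (\<Psi> k)) \<le> \<eta>" and h: "0 \<le> h"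
  shows "dist (\<phi> (e k) (real n * h)) (e ((\<Psi> ^^ n) k)) \<le> real n * \<eta> * exp (L * (real n * h))"
proof (induction n)
  case 0
  then show ?case using fl e by (simp add: is_flow_of_iff)
next
  case (Suc n)
  have L: "0 \<le> L" using lip by (simp add: lipschitz_field_def)
  have \<eta>: "0 \<le> \<eta>" using loc[of k] zero_le_dist order_trans by blast
  let ?y = "\<phi> (e k) (real n * h)" and ?k = "(\<Psi> ^^ n) k"
  have y: "?y \<in> X" using fl e by (simp add: is_flow_of_def)
  have "dist (\<phi> (e k) (real (Suc n) * h)) (e ((\<Psi> ^^ Suc n) k)) = dist (\<phi> ?y h) (e (\<Psi> ?k))"
    using flow_add[OF lip fl e[of k], of "real n * h" h] by (simp add: algebra_simps)
  also have "\<dots> \<le> dist (\<phi> ?y h) (\<phi> (e ?k) h) + dist (\<phi> (e ?k) h) (e (\<Psi> ?k))"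
    by (rule dist_triangle)
  also have "\<dots> \<le> exp (L * h) * (real n * \<eta> * exp (L * (real n * h))) + \<eta>"
    by (intro add_mono loc order_trans[OF flow_dist_le[OF lip fl y e h]] mult_left_mono Suc.IH) simp
  \<comment> \<open>The new error \<eta> is enlarged by an exponential factor of at least 1, so that
    the closed form of the bound reproduces itself.\<close>
  also have "\<dots> \<le> exp (L * h) * (real n * \<eta> * exp (L * (real n * h))) + \<eta> * exp (L * (real (Suc n) * h))"
    using \<eta> L h by (intro add_left_mono) (simp add: mult_le_cancel_left1 mult_nonneg_nonneg)
  also have "\<dots> = real (Suc n) * \<eta> * exp (L * (real (Suc n) * h))"
    by (simp add: algebra_simps exp_add)
  finally show ?case .
qed

lemma has_vector_derivative_vecI:
  fixes f :: "real \<Rightarrow> 'a::euclidean_space ^ 'n"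
  assumes "\<And>i. ((\<lambda>t. f t $ i) has_vector_derivative f' $ i) (at t)"
  shows "(f has_vector_derivative f') (at t)"
  unfolding has_vector_derivative_def
proof (subst has_derivative_componentwise_within, intro ballI)
  fix b :: "'a ^ 'n" assume "b \<in> Basis"
  then obtain i v where b: "b = axis i v" by (auto simp: Basis_vec_def)
  show "((\<lambda>s. f s \<bullet> b) has_derivative (\<lambda>h. (h *\<^sub>R f') \<bullet> b)) (at t)"
    using has_derivative_inner_left[OF assms[of i, unfolded has_vector_derivative_def], of v]
    by (simp add: b inner_axis)
qed

section \<open>Regularity of the replicator field\<close>

text \<open>The bound is carried along because the Lipschitz constant of a product involves bounds
  on the factors, and the replicator field is a polynomial in the coordinates.\<close>

definition bounded_lipschitz :: "'a::metric_space set \<Rightarrow> ('a \<Rightarrow> real) \<Rightarrow> bool"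
  where "bounded_lipschitz X f \<longleftrightarrow>
    (\<exists>B\<ge>0. \<exists>L\<ge>0. \<forall>x\<in>X. \<bar>f x\<bar> \<le> B \<and> (\<forall>y\<in>X. \<bar>f x - f y\<bar> \<le> L * dist x y))"

lemma bounded_lipschitz_const [intro]: "bounded_lipschitz X (\<lambda>x. c)"
  unfolding bounded_lipschitz_def by (rule exI[of _ "\<bar>c\<bar>"]) auto

lemma bounded_lipschitz_diff [intro]:
  assumes "bounded_lipschitz X f" "bounded_lipschitz X g"
  shows "bounded_lipschitz X (\<lambda>x. f x - g x)"
proof -
  from assms(1) obtain B L where f: "0 \<le> B" "0 \<le> L" "\<And>x. x \<in> X \<Longrightarrow> \<bar>f x\<bar> \<le> B"
    "\<And>x y. x \<in> X \<Longrightarrow> y \<in> X \<Longrightarrow> \<bar>f x - f y\<bar> \<le> L * dist x y"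
    unfolding bounded_lipschitz_def by blast
  from assms(2) obtain B' L' where g: "0 \<le> B'" "0 \<le> L'" "\<And>x. x \<in> X \<Longrightarrow> \<bar>g x\<bar> \<le> B'"
    "\<And>x y. x \<in> X \<Longrightarrow> y \<in> X \<Longrightarrow> \<bar>g x - g y\<bar> \<le> L' * dist x y"
    unfolding bounded_lipschitz_def by blast
  have "\<bar>f x - g x\<bar> \<le> B + B'" if "x \<in> X" for x
    using f(3)[OF that] g(3)[OF that] by linarith
  moreover have "\<bar>(f x - g x) - (f y - g y)\<bar> \<le> (L + L') * dist x y" if "x \<in> X" "y \<in> X" for x y
    using f(4)[OF that] g(4)[OF that] unfolding distrib_right by linarith
  ultimately show ?thesis
    unfolding bounded_lipschitz_def using f(1,2) g(1,2)
    by (intro exI[of _ "B + B'"] exI[of _ "L + L'"] conjI) auto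
qed

lemma bounded_lipschitz_add [intro]:
  assumes "bounded_lipschitz X f" "bounded_lipschitz X g"
  shows "bounded_lipschitz X (\<lambda>x. f x + g x)"
  using bounded_lipschitz_diff[OF assms(1) bounded_lipschitz_diff[OF bounded_lipschitz_const[of X 0] assms(2)]]
  by simp

lemma bounded_lipschitz_mult [intro]:
  assumes "bounded_lipschitz X f" "bounded_lipschitz X g"
  shows "bounded_lipschitz X (\<lambda>x. f x * g x)"
proof -
  from assms(1) obtain B L where f: "0 \<le> B" "0 \<le> L" "\<And>x. x \<in> X \<Longrightarrow> \<bar>f x\<bar> \<le> B"
    "\<And>x y. x \<in> X \<Longrightarrow> y \<in> X \<Longrightarrow> \<bar>f x - f y\<bar> \<le> L * dist x y"
    unfolding bounded_lipschitz_def by blast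
  from assms(2) obtain B' L' where g: "0 \<le> B'" "0 \<le> L'" "\<And>x. x \<in> X \<Longrightarrow> \<bar>g x\<bar> \<le> B'"
    "\<And>x y. x \<in> X \<Longrightarrow> y \<in> X \<Longrightarrow> \<bar>g x - g y\<bar> \<le> L' * dist x y"
    unfolding bounded_lipschitz_def by blast
  have "\<bar>f x * g x\<bar> \<le> B * B'" if "x \<in> X" for x
    unfolding abs_mult using f g that by (intro mult_mono) auto
  moreover have "\<bar>f x * g x - f y * g y\<bar> \<le> (L * B' + B * L') * dist x y" if "x \<in> X" "y \<in> X" for x y
  proof -
    have "f x * g x - f y * g y = (f x - f y) * g x + f y * (g x - g y)"
      by (simp add: algebra_simps)
    also have "\<bar>\<dots>\<bar> \<le> \<bar>f x - f y\<bar> * \<bar>g x\<bar> + \<bar>f y\<bar> * \<bar>g x - g y\<bar>"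
      by (metis abs_mult abs_triangle_ineq)
    also have "\<dots> \<le> (L * dist x y) * B' + B * (L' * dist x y)"
      using f g that by (intro add_mono mult_mono) auto
    finally show ?thesis by (simp add: algebra_simps)
  qed
  ultimately show ?thesis
    unfolding bounded_lipschitz_def using f(1,2) g(1,2)
    by (intro exI[of _ "B * B'"] exI[of _ "L * B' + B * L'"] conjI) auto
qed

lemma bounded_lipschitz_sum [intro]:
  assumes "\<And>a. a \<in> A \<Longrightarrow> bounded_lipschitz X (f a)"
  shows "bounded_lipschitz X (\<lambda>x. \<Sum>a\<in>A. f a x)"
  using assms by (induction A rule: infinite_finite_induct) auto

lemma bounded_lipschitz_prod [intro]:
  assumes "\<And>a. a \<in> A \<Longrightarrow> bounded_lipschitz X (f a)"
  shows "bounded_lipschitz X (\<lambda>x. \<Prod>a\<in>A. f a x)"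
  using assms by (induction A rule: infinite_finite_induct) auto

lemma norm_matrix_le:
  fixes v :: "real ^ 's::finite ^ 'n::finite"
  shows "norm v \<le> (\<Sum>i\<in>UNIV. \<Sum>s\<in>UNIV. \<bar>v $ i $ s\<bar>)"
proof -
  have "norm v \<le> (\<Sum>i\<in>UNIV. norm (v $ i))"
    unfolding norm_vec_def by (rule L2_set_le_sum) simp
  also have "\<dots> \<le> (\<Sum>i\<in>UNIV. \<Sum>s\<in>UNIV. \<bar>v $ i $ s\<bar>)"
    by (intro sum_mono norm_le_l1_cart)
  finally show ?thesis .
qed

lemma norm_axis: "norm (axis i v) = norm (v :: 'a::real_normed_vector)"
proof -
  have "norm (axis i v) = sqrt (\<Sum>j\<in>UNIV. if j = i then (norm v)\<^sup>2 else 0)"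
    unfolding norm_vec_def L2_set_def by (intro arg_cong[of _ _ sqrt] sum.cong) (auto simp: axis_def)
  then show ?thesis by simp
qed

section \<open>Coordinates of mixed profiles and regularity of payoffs\<close>

lemma mixed_profiles_nonneg: "x \<in> mixed_profiles S \<Longrightarrow> 0 \<le> x $ i $ s"
  by (simp add: mixed_profiles_def)

lemma mixed_profiles_outside: "x \<in> mixed_profiles S \<Longrightarrow> s \<notin> S i \<Longrightarrow> x $ i $ s = 0"
  by (simp add: mixed_profiles_def)

lemma sum_mixed_profile:
  assumes "x \<in> mixed_profiles S"
  shows "(\<Sum>s\<in>S i. x $ i $ s * f s) = (\<Sum>s\<in>UNIV. x $ i $ s * f s)"
  using mixed_profiles_outside[OF assms] by (intro sum.mono_neutral_left) auto

lemma mixed_profiles_sum: "x \<in> mixed_profiles S \<Longrightarrow> (\<Sum>s\<in>UNIV. x $ i $ s) = 1"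
  using sum_mixed_profile[of x S i "\<lambda>s. 1"] by (simp add: mixed_profiles_def)

lemma mixed_profilesI:
  assumes "\<And>i s. 0 \<le> x $ i $ s" "\<And>i s. s \<notin> S i \<Longrightarrow> x $ i $ s = 0" "\<And>i. (\<Sum>s\<in>UNIV. x $ i $ s) = 1"
  shows "x \<in> mixed_profiles S"
proof -
  have "(\<Sum>s\<in>S i. x $ i $ s) = (\<Sum>s\<in>UNIV. x $ i $ s)" for i
    using assms(2) by (intro sum.mono_neutral_left) auto
  then show ?thesis using assms by (simp add: mixed_profiles_def)
qed

lemma mixed_profiles_support:
  assumes "x \<in> mixed_profiles S"
  obtains s where "x $ i $ s \<noteq> 0"
proof -
  have "(\<Sum>s\<in>UNIV. x $ i $ s) \<noteq> 0" using mixed_profiles_sum[OF assms] by simp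
  then show ?thesis using that by (meson sum.not_neutral_contains_not_neutral)
qed

lemma mixed_profiles_le_1:
  assumes "x \<in> mixed_profiles S"
  shows "x $ i $ s \<le> 1"
  using member_le_sum[of s UNIV "\<lambda>s. x $ i $ s"] mixed_profiles_nonneg[OF assms]
  by (simp add: mixed_profiles_sum[OF assms])

lemma bounded_lipschitz_coord:
  fixes S :: "'n::finite \<Rightarrow> 's::finite set"
  shows "bounded_lipschitz (mixed_profiles S) (\<lambda>x. x $ i $ s)"
proof -
  have "\<bar>x $ i $ s - y $ i $ s\<bar> \<le> 1 * dist x y" for x y :: "real ^ 's ^ 'n"
    using order_trans[OF Finite_Cartesian_Product.norm_nth_le[of "(x - y) $ i" s]
        Finite_Cartesian_Product.norm_nth_le[of "x - y" i]]
    by (simp add: dist_norm)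
  then show ?thesis
    unfolding bounded_lipschitz_def
    by (intro exI[of _ 1] conjI) (auto simp: abs_of_nonneg mixed_profiles_le_1 mixed_profiles_nonneg)
qed

lemma strategy_utility_eq:
  "strategy_utility S u i s x =
    (\<Sum>q\<in>profiles S. (\<Prod>j\<in>UNIV. (if j = i then axis s 1 $ q j else x $ j $ q j)) * u q $ i)"
  unfolding strategy_utility_def expected_utility_def
  by (simp add: if_distrib[of "\<lambda>v. v $ _"] cong: if_cong)

lemma strategy_utility_cong:
  assumes "\<And>j. j \<noteq> i \<Longrightarrow> x $ j = y $ j"
  shows "strategy_utility S u i s x = strategy_utility S u i s y"
  unfolding strategy_utility_eq using assms
  by (intro sum.cong arg_cong2[of _ _ _ _ "(*)"] prod.cong) auto

lemma bounded_lipschitz_strategy_utility: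
  "bounded_lipschitz (mixed_profiles S) (strategy_utility S u i s)"
proof -
  have "bounded_lipschitz (mixed_profiles S) (\<lambda>x. if j = i then axis s 1 $ q j else x $ j $ q j)"
    for j q
    by (cases "j = i") (auto intro: bounded_lipschitz_coord)
  then have "bounded_lipschitz (mixed_profiles S) (\<lambda>x. strategy_utility S u i s x)"
    unfolding strategy_utility_eq
    by (intro bounded_lipschitz_sum bounded_lipschitz_mult bounded_lipschitz_prod bounded_lipschitz_const)
  then show ?thesis by simp
qed

lemma bounded_lipschitz_replicator_field:
  "bounded_lipschitz (mixed_profiles S) (\<lambda>x. replicator_field S u x $ i $ s)"
  unfolding replicator_field_def vec_lambda_beta
  by (intro bounded_lipschitz_mult bounded_lipschitz_diff bounded_lipschitz_sum
      bounded_lipschitz_coord bounded_lipschitz_strategy_utility)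

lemma replicator_field_lipschitz:
  obtains L M where "lipschitz_field (replicator_field S u) (mixed_profiles S) L" "0 \<le> M"
    "\<And>x. x \<in> mixed_profiles S \<Longrightarrow> norm (replicator_field S u x) \<le> M"
proof -
  let ?X = "mixed_profiles S" and ?F = "replicator_field S u"
  have "\<forall>i s. \<exists>B L. 0 \<le> B \<and> 0 \<le> L \<and> (\<forall>x\<in>?X. \<bar>?F x $ i $ s\<bar> \<le> B \<and>
      (\<forall>y\<in>?X. \<bar>?F x $ i $ s - ?F y $ i $ s\<bar> \<le> L * dist x y))"
    using bounded_lipschitz_replicator_field unfolding bounded_lipschitz_def by blast
  then obtain B L where BL: "\<And>i s. 0 \<le> B i s" "\<And>i s. 0 \<le> L i s"
    "\<And>i s x. x \<in> ?X \<Longrightarrow> \<bar>?F x $ i $ s\<bar> \<le> B i s"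
    "\<And>i s x y. x \<in> ?X \<Longrightarrow> y \<in> ?X \<Longrightarrow> \<bar>?F x $ i $ s - ?F y $ i $ s\<bar> \<le> L i s * dist x y"
    by metis
  have "norm (?F x) \<le> (\<Sum>i\<in>UNIV. \<Sum>s\<in>UNIV. B i s)" if "x \<in> ?X" for x
    by (rule order_trans[OF norm_matrix_le]) (intro sum_mono BL that)
  moreover have "norm (?F x - ?F y) \<le> (\<Sum>i\<in>UNIV. \<Sum>s\<in>UNIV. L i s) * norm (x - y)"
    if "x \<in> ?X" "y \<in> ?X" for x y
    unfolding sum_distrib_right
    by (rule order_trans[OF norm_matrix_le])
       (use BL(4)[OF that] in \<open>auto intro!: sum_mono simp: dist_norm\<close>)
  ultimately show ?thesis
    by (intro that[of "\<Sum>i\<in>UNIV. \<Sum>s\<in>UNIV. L i s" "\<Sum>i\<in>UNIV. \<Sum>s\<in>UNIV. B i s"])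
       (auto simp: lipschitz_field_def sum_nonneg BL(1,2))
qed

lemma replicator_field_minus: "replicator_field S (\<lambda>q. - u q) x = - replicator_field S u x"
proof -
  have "strategy_utility S (\<lambda>q. - u q) i s x = - strategy_utility S u i s x" for i s
    unfolding strategy_utility_eq by (simp add: sum_negf)
  then show ?thesis
    by (simp add: replicator_field_def vec_eq_iff sum_negf algebra_simps)
qed

section \<open>Reweighting and the motion of a single player\<close>

text \<open>These summands of the replicator field can be integrated in closed form one at a time.
  Composing their flows approximates the full flow, as in Lie-Trotter splitting.\<close>

definition player_field ::
  "('n::finite \<Rightarrow> 's::finite set) \<Rightarrow> (('n \<Rightarrow> 's) \<Rightarrow> real ^ 'n) \<Rightarrow> 'n \<Rightarrow> real ^ 's ^ 'n \<Rightarrow> real ^ 's ^ 'n"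
  where "player_field S u i x = axis i (replicator_field S u x $ i)"

lemma norm_player_field_le: "norm (player_field S u i x) \<le> norm (replicator_field S u x)"
  unfolding player_field_def norm_axis by (rule Finite_Cartesian_Product.norm_nth_le)

lemma lipschitz_player_field:
  assumes "lipschitz_field (replicator_field S u) X L"
  shows "lipschitz_field (player_field S u i) X L"
proof -
  have "norm (player_field S u i x - player_field S u i y)
      \<le> norm (replicator_field S u x - replicator_field S u y)" for x y
  proof -
    have "player_field S u i x - player_field S u i y
        = axis i ((replicator_field S u x - replicator_field S u y) $ i)"
      by (simp add: player_field_def vec_eq_iff axis_def)
    then show ?thesis by (metis norm_axis Finite_Cartesian_Product.norm_nth_le)
  qed
  then show ?thesis using assms unfolding lipschitz_field_def by (meson order_trans)
qed

lemma sum_player_field: "(\<Sum>i\<in>UNIV. player_field S u i x) = replicator_field S u x"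
  by (simp add: player_field_def vec_eq_iff axis_def)

text \<open>The multiplicative weights update: in logits, translation by \<open>ln (w i s)\<close>.
  Positive weights preserve the support, and scaling all weights of one player by a positive
  constant has no effect.\<close>

definition reweight :: "('n \<Rightarrow> 's \<Rightarrow> real) \<Rightarrow> real ^ 's::finite ^ 'n::finite \<Rightarrow> real ^ 's ^ 'n"
  where "reweight w x = (\<chi> i s. x $ i $ s * w i s / (\<Sum>r\<in>UNIV. x $ i $ r * w i r))"

lemma reweight_nth: "reweight w x $ i $ s = x $ i $ s * w i s / (\<Sum>r\<in>UNIV. x $ i $ r * w i r)"
  by (simp add: reweight_def)

lemma weight_sum_pos:
  assumes x: "x \<in> mixed_profiles S" and w: "\<And>s. 0 < w s"
  shows "0 < (\<Sum>s\<in>UNIV. x $ i $ s * w s)"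
proof -
  obtain s where s: "x $ i $ s \<noteq> 0" using mixed_profiles_support[OF x] by blast
  show ?thesis
    using s w mixed_profiles_nonneg[OF x] less_le
    by (intro sum_pos2[of _ s]) (auto simp: less_le intro: less_imp_le)
qed

lemma reweight_in:
  assumes x: "x \<in> mixed_profiles S" and w: "\<And>i s. 0 < w i s"
  shows "reweight w x \<in> mixed_profiles S"
proof (rule mixed_profilesI)
  have p: "0 < (\<Sum>r\<in>UNIV. x $ i $ r * w i r)" for i
    by (rule weight_sum_pos[OF x w])
  show "0 \<le> reweight w x $ i $ s" for i s
    using mixed_profiles_nonneg[OF x, of i s] w[of i s] p[of i] by (simp add: reweight_nth less_imp_le)
  show "reweight w x $ i $ s = 0" if "s \<notin> S i" for i s
    using mixed_profiles_outside[OF x that] by (simp add: reweight_nth)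
  show "(\<Sum>s\<in>UNIV. reweight w x $ i $ s) = 1" for i
    using p[of i] by (simp add: reweight_nth flip: sum_divide_distrib)
qed

lemma reweight_reweight:
  assumes x: "x \<in> mixed_profiles S" and w: "\<And>i s. 0 < w i s"
  shows "reweight v (reweight w x) = reweight (\<lambda>i s. w i s * v i s) x"
proof -
  have "reweight v (reweight w x) $ i $ s = reweight (\<lambda>i s. w i s * v i s) x $ i $ s" for i s
  proof -
    let ?Z = "\<Sum>r\<in>UNIV. x $ i $ r * w i r"
    have "(\<Sum>r\<in>UNIV. reweight w x $ i $ r * v i r) = (\<Sum>r\<in>UNIV. x $ i $ r * (w i r * v i r)) / ?Z"
      unfolding sum_divide_distrib by (intro sum.cong) (auto simp: reweight_nth)
    then show ?thesis
      using weight_sum_pos[OF x, of "w i" i] w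
      by (simp add: reweight_nth[of v] reweight_nth[of "\<lambda>i s. w i s * v i s"]) (simp add: reweight_nth)
  qed
  then show ?thesis by (simp add: vec_eq_iff)
qed

lemma reweight_const:
  assumes "x \<in> mixed_profiles S" "\<And>s. w i s = 1"
  shows "reweight w x $ i = x $ i"
  by (simp add: vec_eq_iff reweight_nth assms mixed_profiles_sum[OF assms(1)])

text \<open>Only weight ratios within one player matter, so the weights need to agree only up to a
  common factor \<open>c i\<close>. The normalizing sums then obey the same two-sided estimate as
  the weights, and each new probability \<open>p\<close> changes by at most
  \<open>p * (exp \<delta> - 1)\<close>. Summing over the strategies removes \<open>p\<close>, which
  makes the bound independent of the point and of the weights.\<close>

lemma reweight_close:
  assumes x: "x \<in> mixed_profiles S" and w: "\<And>i s. 0 < w i s" "\<And>i s. 0 < v i s"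
    and c: "\<And>i. 0 < c i"
    and up: "\<And>i s. x $ i $ s \<noteq> 0 \<Longrightarrow> v i s \<le> c i * w i s"
    and lo: "\<And>i s. x $ i $ s \<noteq> 0 \<Longrightarrow> c i * w i s \<le> exp \<delta> * v i s"
    and \<delta>: "0 \<le> \<delta>"
  shows "norm (reweight v x - reweight w x :: real ^ 's ^ 'n) \<le> real CARD('n::finite) * (exp \<delta> - 1)"
proof -
  have 1: "\<bar>reweight v x $ i $ s - reweight w x $ i $ s\<bar> \<le> reweight w x $ i $ s * (exp \<delta> - 1)" for i s
  proof (cases "x $ i $ s = 0")
    case True
    then show ?thesis by (simp add: reweight_nth)
  next
    case False
    let ?W = "\<Sum>r\<in>UNIV. x $ i $ r * w i r" and ?V = "\<Sum>r\<in>UNIV. x $ i $ r * v i r"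
    let ?a = "x $ i $ s"
    have a: "0 < ?a" using False mixed_profiles_nonneg[OF x, of i s] by simp
    have W: "0 < ?W" and V: "0 < ?V"
      using weight_sum_pos[OF x, of "w i" i] weight_sum_pos[OF x, of "v i" i] w by auto
    have VW: "?V \<le> c i * ?W"
      unfolding sum_distrib_left
    proof (rule sum_mono)
      fix r show "x $ i $ r * v i r \<le> c i * (x $ i $ r * w i r)"
        using mult_left_mono[OF up[of i r] mixed_profiles_nonneg[OF x, of i r]]
        by (cases "x $ i $ r = 0") (auto simp: mult_ac)
    qed
    have WV: "c i * ?W \<le> exp \<delta> * ?V"
      unfolding sum_distrib_left
    proof (rule sum_mono)
      fix r show "c i * (x $ i $ r * w i r) \<le> exp \<delta> * (x $ i $ r * v i r)"
        using mult_left_mono[OF lo[of i r] mixed_profiles_nonneg[OF x, of i r]]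
        by (cases "x $ i $ r = 0") (auto simp: mult_ac)
    qed
    define p where "p = ?a * w i s / ?W"
    define q where "q = ?a * v i s / ?V"
    have p0: "0 < p" using a w W by (simp add: p_def)
    have "q \<le> ?a * (c i * w i s) / ?V"
      unfolding q_def using up[OF False] a V by (intro divide_right_mono mult_left_mono) auto
    also have "\<dots> \<le> exp \<delta> * p"
      using mult_left_mono[OF WV, of "?a * w i s"] a w[of i s] V W
      by (simp add: p_def divide_simps mult_ac)
    finally have qp: "q \<le> exp \<delta> * p" .
    have "p = ?a * (c i * w i s) / (c i * ?W)" using c[of i] by (simp add: p_def)
    also have "\<dots> \<le> ?a * (exp \<delta> * v i s) / (c i * ?W)"
      using lo[OF False] a W c[of i] by (intro divide_right_mono mult_left_mono) auto
    also have "\<dots> \<le> ?a * (exp \<delta> * v i s) / ?V"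
      using VW V W c[of i] a w(2)[of i s] by (intro divide_left_mono) auto
    also have "\<dots> = exp \<delta> * q" by (simp add: q_def)
    finally have "exp (- \<delta>) * p \<le> q" by (simp add: exp_minus field_simps)
    \<comment> \<open>This is \<open>1 - exp (- \<delta>) \<le> exp \<delta> - 1\<close>: the
      downward deviation obeys the same bound as the upward one.\<close>
    moreover have "(exp (- \<delta>) + exp \<delta>) * p \<ge> 2 * p"
    proof (intro mult_right_mono)
      show "2 \<le> exp (- \<delta>) + exp \<delta>"
        using exp_ge_add_one_self[of \<delta>] exp_ge_add_one_self[of "- \<delta>"] by linarith
    qed (use p0 in auto)
    ultimately have "p - q \<le> p * (exp \<delta> - 1)" by (simp add: algebra_simps)
    with qp have "\<bar>q - p\<bar> \<le> p * (exp \<delta> - 1)" by (simp add: algebra_simps abs_le_iff)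
    then show ?thesis by (simp add: p_def q_def reweight_nth)
  qed
  have "norm (reweight v x - reweight w x)
      \<le> (\<Sum>i\<in>UNIV. \<Sum>s\<in>UNIV. reweight w x $ i $ s * (exp \<delta> - 1))"
    using 1 by (intro order_trans[OF norm_matrix_le] sum_mono) auto
  also have "\<dots> = real CARD('n) * (exp \<delta> - 1)"
    using mixed_profiles_sum[OF reweight_in[OF x w(1)]] by (simp flip: sum_distrib_right)
  finally show ?thesis .
qed

text \<open>
  A player's payoffs do not depend on that player's own mixture, so while the others stay put the
  player's weights grow at constant exponential rates.
\<close>

lemma player_curve:
  assumes x: "x \<in> mixed_profiles S"
  shows "integral_curve (player_field S u i) (mixed_profiles S)
    (\<lambda>t. reweight (\<lambda>j s. if j = i then exp (t * strategy_utility S u i s x) else 1) x)"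
proof -
  define g where "g s = strategy_utility S u i s x" for s
  define z where "z t = reweight (\<lambda>j s. if j = i then exp (t * g s) else 1) x" for t
  have zX: "z t \<in> mixed_profiles S" for t
    unfolding z_def by (rule reweight_in[OF x]) auto
  have zj: "z t $ j = x $ j" if "j \<noteq> i" for t j
    unfolding z_def using that by (intro reweight_const[OF x]) auto
  have zi: "z t $ i $ s = x $ i $ s * exp (t * g s) / (\<Sum>r\<in>UNIV. x $ i $ r * exp (t * g r))" for t s
    by (simp add: z_def reweight_nth)
  have g: "strategy_utility S u i s (z t) = g s" for s t
    unfolding g_def by (rule strategy_utility_cong) (rule zj)
  have F: "player_field S u i (z t) $ i $ s = z t $ i $ s * (g s - (\<Sum>r\<in>UNIV. z t $ i $ r * g r))" for t s
    by (simp add: player_field_def axis_def replicator_field_def g sum_mixed_profile[OF zX])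
  have "(z has_vector_derivative player_field S u i (z t)) (at t)" for t
  proof (intro has_vector_derivative_vecI)
    fix j s
    show "((\<lambda>t. z t $ j $ s) has_vector_derivative player_field S u i (z t) $ j $ s) (at t)"
    proof (cases "j = i")
      case False
      then show ?thesis by (simp add: zj player_field_def axis_def)
    next
      case True
      let ?Z = "\<lambda>t. \<Sum>r\<in>UNIV. x $ i $ r * exp (t * g r)"
      let ?D = "\<Sum>r\<in>UNIV. x $ i $ r * (exp (t * g r) * g r)"
      have Z: "?Z t \<noteq> 0" using weight_sum_pos[OF x, of "\<lambda>r. exp (t * g r)" i] by simp
      have dZ: "(?Z has_real_derivative ?D) (at t)"
        by (rule derivative_eq_intros refl | simp add: mult_ac)+
      have "((\<lambda>t. x $ i $ s * exp (t * g s) / ?Z t) has_real_derivative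
          (x $ i $ s * (exp (t * g s) * g s) * ?Z t - x $ i $ s * exp (t * g s) * ?D) / (?Z t * ?Z t)) (at t)"
        by (rule DERIV_divide) (rule derivative_eq_intros dZ Z refl | simp)+
      moreover have "(\<Sum>r\<in>UNIV. z t $ i $ r * g r) = ?D / ?Z t"
        unfolding sum_divide_distrib by (intro sum.cong) (auto simp: zi)
      ultimately show ?thesis
        using Z unfolding True F unfolding zi has_real_derivative_iff_has_vector_derivative[symmetric]
        by (simp add: diff_divide_distrib algebra_simps)
    qed
  qed
  then have "integral_curve (player_field S u i) (mixed_profiles S) z"
    using zX by (simp add: integral_curve_def)
  then show ?thesis unfolding z_def[abs_def] g_def .
qed

section \<open>Lattice approximation of the flow\<close>

text \<open>
  Points of the relative interior of the face of \<open>x\<close> are parametrized by logits in \<open>\<delta>\<int>\<close>, relative to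
  the base strategies \<open>b\<close>; the origin of the lattice is \<open>x\<close> itself. Strategies outside the support
  of \<open>x\<close> keep the coordinate \<open>0\<close>.
\<close>

locale logit_lattice =
  fixes S :: "'n::finite \<Rightarrow> 's::finite set" and u :: "('n \<Rightarrow> 's) \<Rightarrow> real ^ 'n"
    and x :: "real ^ 's ^ 'n" and b :: "'n \<Rightarrow> 's" and \<delta> h :: real
  assumes x: "x \<in> mixed_profiles S" and b: "\<And>i. x $ i $ b i \<noteq> 0" and \<delta>: "0 < \<delta>" and h: "0 \<le> h"
begin

definition pt :: "('n \<Rightarrow> 's \<Rightarrow> int) \<Rightarrow> real ^ 's ^ 'n"
  where "pt k = reweight (\<lambda>i s. exp (\<delta> * of_int (k i s))) x"

text \<open>In logits relative to \<open>b i\<close>, the exact motion of player i for time h is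
  translation by h times the payoff advantage over \<open>b i\<close>. The displacement is counted
  in units of \<delta> and rounded down. Subtracting the payoff of \<open>b i\<close> keeps the base
  coordinate at 0.\<close>

definition shear :: "'n \<Rightarrow> ('n \<Rightarrow> 's \<Rightarrow> int) \<Rightarrow> 'n \<Rightarrow> 's \<Rightarrow> int"
  where "shear i k = (\<lambda>j s. if j = i \<and> x $ i $ s \<noteq> 0
    then k i s + \<lfloor>h * (strategy_utility S u i s (pt k) - strategy_utility S u i (b i) (pt k)) / \<delta>\<rfloor>
    else k j s)"

text \<open>Adding a constant to a player's row, or changing entries off the support, leaves
  \<open>pt k\<close> fixed. Without removing this freedom a large entry would say nothing about
  closeness to the boundary.\<close>

definition normalized :: "('n \<Rightarrow> 's \<Rightarrow> int) \<Rightarrow> bool"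
  where "normalized k \<longleftrightarrow> (\<forall>i. k i (b i) = 0 \<and> (\<forall>s. x $ i $ s = 0 \<longrightarrow> k i s = 0))"

definition bump :: "'n \<Rightarrow> 's \<Rightarrow> ('n \<Rightarrow> 's \<Rightarrow> int) \<Rightarrow> 'n \<Rightarrow> 's \<Rightarrow> int"
  where "bump i s k = k(i := (k i)(s := k i s + 1))"

text \<open>The bound of \<open>reweight_close\<close>, which covers both one \<open>bump\<close>
  and the rounding in one \<open>shear\<close>.\<close>

definition mesh :: real
  where "mesh = real CARD('n) * (exp \<delta> - 1)"

lemma pt_in: "pt k \<in> mixed_profiles S"
  unfolding pt_def by (rule reweight_in[OF x]) simp

lemma pt_0: "pt (\<lambda>i s. 0) = x"
  by (simp add: pt_def vec_eq_iff reweight_nth mixed_profiles_sum[OF x])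

lemma pt_cong: "k j = k' j \<Longrightarrow> pt k $ j = pt k' $ j"
  by (simp add: pt_def vec_eq_iff reweight_nth)

lemma pt_eq_0_iff: "pt k $ i $ s = 0 \<longleftrightarrow> x $ i $ s = 0"
  using weight_sum_pos[OF x, of "\<lambda>r. exp (\<delta> * of_int (k i r))" i] by (simp add: pt_def reweight_nth)

lemma bump_dist: "norm (pt (bump i s k) - pt k) \<le> mesh"
  unfolding pt_def mesh_def
  by (rule reweight_close[OF x, where c = "\<lambda>j. if j = i then exp \<delta> else 1"])
     (use \<delta> in \<open>auto simp: bump_def algebra_simps simp flip: exp_add\<close>)

lemma normalized_bump:
  "normalized k \<Longrightarrow> s \<noteq> b i \<Longrightarrow> x $ i $ s \<noteq> 0 \<Longrightarrow> normalized (bump i s k)"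
  by (auto simp: normalized_def bump_def)

lemma normalized_shear: "normalized k \<Longrightarrow> normalized (shear i k)"
  by (auto simp: normalized_def shear_def)

text \<open>
  The displacement of coordinate \<open>i\<close> depends on the other coordinates only. This shear structure, the
  discrete form of Liouville's theorem in logit coordinates, survives the rounding.
\<close>

lemma inj_shear: "inj (shear i)"
proof (rule injI)
  fix k k' assume eq: "shear i k = shear i k'"
  have j: "k j = k' j" if "j \<noteq> i" for j
    using fun_cong[OF eq, of j] that by (auto simp: shear_def fun_eq_iff)
  then have V: "strategy_utility S u i s (pt k) = strategy_utility S u i s (pt k')" for s
    by (intro strategy_utility_cong pt_cong) auto
  have "k i s = k' i s" for s
    using fun_cong[OF fun_cong[OF eq], of i s] by (auto simp: shear_def V split: if_splits)
  with j show "k = k'" by (metis ext)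
qed

text \<open>The payoff of \<open>b i\<close> enters as a factor common to all strategies of player i
  and is absorbed into \<open>c\<close>. What remains is the rounding error, between 0 and \<delta>
  in every logit.\<close>

lemma shear_near_player_curve:
  "norm (pt (shear i k)
    - reweight (\<lambda>j s. if j = i then exp (h * strategy_utility S u i s (pt k)) else 1) (pt k)) \<le> mesh"
proof -
  let ?V = "\<lambda>s. strategy_utility S u i s (pt k)"
  define v where "v s = h * (?V s - ?V (b i))" for s
  define c where "c j = (if j = i then exp (- (h * ?V (b i))) else 1)" for j
  have fl: "\<delta> * of_int \<lfloor>v s / \<delta>\<rfloor> \<le> v s" "v s \<le> \<delta> + \<delta> * of_int \<lfloor>v s / \<delta>\<rfloor>" for s
  proof -
    have "of_int \<lfloor>v s / \<delta>\<rfloor> \<le> v s / \<delta>" "v s / \<delta> \<le> 1 + of_int \<lfloor>v s / \<delta>\<rfloor>"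
      by linarith+
    from mult_left_mono[OF this(1), of \<delta>] mult_left_mono[OF this(2), of \<delta>]
    show "\<delta> * of_int \<lfloor>v s / \<delta>\<rfloor> \<le> v s" "v s \<le> \<delta> + \<delta> * of_int \<lfloor>v s / \<delta>\<rfloor>"
      using \<delta> by (auto simp: distrib_left)
  qed
  have sh: "shear i k j s = (if j = i \<and> x $ i $ s \<noteq> 0 then k i s + \<lfloor>v s / \<delta>\<rfloor> else k j s)" for j s
    by (simp add: shear_def v_def)
  show ?thesis
    unfolding pt_def[of k] pt_def[of "shear i k"] reweight_reweight[OF x exp_gt_zero] mesh_def
  proof (rule reweight_close[OF x, where c = c], goal_cases)
    case (4 j s)
    then show ?case using fl(1)[of s]
      by (auto simp: c_def sh v_def pt_def[symmetric] algebra_simps simp flip: exp_add)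
  next
    case (5 j s)
    then show ?case using fl(2)[of s] \<delta>
      by (auto simp: c_def sh v_def pt_def[symmetric] algebra_simps simp flip: exp_add)
  qed (use \<delta> in \<open>auto simp: c_def\<close>)
qed

section \<open>Error of one sweep over the players against the flow\<close>

context
  fixes L M :: real
  assumes lip: "lipschitz_field (replicator_field S u) (mixed_profiles S) L"
    and bd: "\<And>y. y \<in> mixed_profiles S \<Longrightarrow> norm (replicator_field S u y) \<le> M"
begin

lemma bd_player: "y \<in> mixed_profiles S \<Longrightarrow> norm (player_field S u i y) \<le> M"
  using bd norm_player_field_le order_trans by blast

lemma shear_dist: "norm (pt (shear i k) - pt k) \<le> M * h + mesh"
proof -
  let ?z = "\<lambda>t. reweight (\<lambda>j s. if j = i then exp (t * strategy_utility S u i s (pt k)) else 1) (pt k)"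
  have z0: "?z 0 = pt k" by (simp add: vec_eq_iff reweight_nth mixed_profiles_sum[OF pt_in] cong: if_cong)
  have "norm (?z h - ?z 0) \<le> M * h"
    by (rule integral_curve_dist_le[OF player_curve[OF pt_in] bd_player h])
  from norm_diff_triangle_le[OF shear_near_player_curve this]
  show ?thesis unfolding z0 by (simp only: add.commute)
qed

lemma shear_euler:
  "norm (pt (shear i k) - pt k - h *\<^sub>R player_field S u i (pt k)) \<le> L * M * h\<^sup>2 + mesh"
proof -
  let ?z = "\<lambda>t. reweight (\<lambda>j s. if j = i then exp (t * strategy_utility S u i s (pt k)) else 1) (pt k)"
  have z0: "?z 0 = pt k" by (simp add: vec_eq_iff reweight_nth mixed_profiles_sum[OF pt_in] cong: if_cong)
  have "norm (?z h - ?z 0 - h *\<^sub>R player_field S u i (?z 0)) \<le> L * M * h\<^sup>2"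
    by (rule integral_curve_euler_error[OF lipschitz_player_field[OF lip] player_curve[OF pt_in] bd_player h])
  then have "norm (?z h - (pt k + h *\<^sub>R player_field S u i (pt k))) \<le> L * M * h\<^sup>2"
    unfolding z0 by (simp only: diff_diff_eq)
  from norm_diff_triangle_le[OF shear_near_player_curve this]
  show ?thesis by (simp only: add.commute diff_diff_eq)
qed

text \<open>All player fields are evaluated at the starting point, although later players move from
  a displaced one. Each earlier shear displaces by at most \<open>M * h + mesh\<close> and so
  changes each later Euler step by at most \<open>h * L * (M * h + mesh)\<close>. The number of such
  pairs accounts for the square of the length.\<close>

lemma fold_shear_euler:
  "norm (pt (fold shear ps k) - pt k - h *\<^sub>R (\<Sum>i\<leftarrow>ps. player_field S u i (pt k)))
    \<le> real (length ps) * (L * M * h\<^sup>2 + mesh) + h * L * (M * h + mesh) * (real (length ps))\<^sup>2"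
proof (induction ps arbitrary: k)
  case (Cons i ps)
  let ?k = "shear i k" and ?E = "L * M * h\<^sup>2 + mesh" and ?K = "M * h + mesh" and ?m = "real (length ps)"
  let ?F = "\<lambda>y. \<Sum>i\<leftarrow>ps. player_field S u i y"
  have L: "0 \<le> L" using lip by (simp add: lipschitz_field_def)
  have K: "0 \<le> ?K" using order_trans[OF norm_ge_zero shear_dist] .
  have "norm (?F (pt ?k) - ?F (pt k)) \<le> ?m * (L * ?K)"
  proof (induction ps)
    case (Cons j ps)
    have "norm (player_field S u j (pt ?k) - player_field S u j (pt k)) \<le> L * norm (pt ?k - pt k)"
      using lipschitz_player_field[OF lip, of j] pt_in by (auto simp: lipschitz_field_def)
    also have "\<dots> \<le> L * ?K" by (intro mult_left_mono shear_dist L)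
    finally have 1: "norm (player_field S u j (pt ?k) - player_field S u j (pt k)) \<le> L * ?K" .
    show ?case
      using order_trans[OF norm_diff_triangle_ineq add_mono[OF 1 Cons.IH]] by (simp add: distrib_right)
  qed simp
  then have F: "norm (h *\<^sub>R (?F (pt ?k) - ?F (pt k))) \<le> h * (?m * (L * ?K))"
    using h by (simp add: mult_left_mono)
  have split: "pt (fold shear (i # ps) k) - pt k - h *\<^sub>R (\<Sum>i\<leftarrow>i # ps. player_field S u i (pt k))
      = (pt (fold shear ps ?k) - pt ?k - h *\<^sub>R ?F (pt ?k)) + (pt ?k - pt k - h *\<^sub>R player_field S u i (pt k))
        + h *\<^sub>R (?F (pt ?k) - ?F (pt k))" (is "?lhs = ?a + ?b + ?c")
    by (simp add: algebra_simps)
  have sum: "norm ?lhs \<le> (?m * ?E + h * L * ?K * ?m\<^sup>2 + ?E) + h * (?m * (L * ?K))"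
    unfolding split
    by (rule order_trans[OF norm_triangle_ineq add_mono[OF order_trans[OF norm_triangle_ineq
        add_mono[OF Cons.IH shear_euler]] F]])
  have "(m * E + h * L * K * m\<^sup>2 + E) + h * (m * (L * K)) \<le> (m + 1) * E + h * L * K * (m + 1)\<^sup>2"
    if "0 \<le> m" "0 \<le> K" for m E K :: real
  proof -
    have "(m + 1) * E + h * L * K * (m + 1)\<^sup>2
        = (m * E + h * L * K * m\<^sup>2 + E) + h * (m * (L * K)) + h * L * K * (m + 1)"
      by (simp add: power2_eq_square algebra_simps)
    moreover have "0 \<le> h * L * K * (m + 1)" using that h L by simp
    ultimately show ?thesis by linarith
  qed
  from order_trans[OF sum this[OF of_nat_0_le_iff K]]
  have "norm ?lhs \<le> (?m + 1) * ?E + h * L * ?K * (?m + 1)\<^sup>2" .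
  moreover have "real (length (i # ps)) = ?m + 1" by simp
  ultimately show ?case by (simp only:)
qed simp

text \<open>Flow and sweep are both compared with the same Euler step: when every player moves
  exactly once, the player fields add up to the replicator field.\<close>

lemma sweep_error:
  assumes fl: "is_flow_of (replicator_field S u) (mixed_profiles S) \<phi>"
    and ps: "distinct ps" "set ps = UNIV"
  shows "dist (\<phi> (pt k) h) (pt (fold shear ps k))
    \<le> L * M * h\<^sup>2 + (real CARD('n) * (L * M * h\<^sup>2 + mesh) + h * L * (M * h + mesh) * (real CARD('n))\<^sup>2)"
proof -
  have len: "length ps = CARD('n)" using distinct_card[OF ps(1)] unfolding ps(2) ..
  have sum: "(\<Sum>i\<leftarrow>ps. player_field S u i (pt k)) = replicator_field S u (pt k)"
    unfolding sum_list_distinct_conv_sum_set[OF ps(1)] ps(2) by (rule sum_player_field)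
  have c: "integral_curve (replicator_field S u) (mixed_profiles S) (\<phi> (pt k))" "\<phi> (pt k) 0 = pt k"
    using bspec[OF fl[unfolded is_flow_of_iff] pt_in[of k]] by blast+
  have eul: "norm (\<phi> (pt k) h - pt k - h *\<^sub>R replicator_field S u (pt k)) \<le> L * M * h\<^sup>2"
    using integral_curve_euler_error[OF lip c(1) bd h] unfolding c(2) .
  have cancel: "a - c = (a - p - q) - (c - p - q)" for a c p q :: "real ^ 's ^ 'n"
    by simp
  have "dist (\<phi> (pt k) h) (pt (fold shear ps k))
      = norm ((\<phi> (pt k) h - pt k - h *\<^sub>R replicator_field S u (pt k))
        - (pt (fold shear ps k) - pt k - h *\<^sub>R replicator_field S u (pt k)))"
    unfolding dist_norm by (rule arg_cong[where f = norm, OF cancel])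
  also have "\<dots> \<le> L * M * h\<^sup>2 + (real CARD('n) * (L * M * h\<^sup>2 + mesh)
      + h * L * (M * h + mesh) * (real CARD('n))\<^sup>2)"
    by (rule order_trans[OF norm_triangle_ineq4 add_mono[OF eul fold_shear_euler[of ps k, unfolded sum len]]])
  finally show ?thesis .
qed

end

text \<open>
  On a finite reachable set the injection \<open>\<Psi>\<close> would be onto, so that the set would be closed under
  the translation \<open>bump i s\<close>, which has no finite invariant set.
\<close>

lemma orbit_unbounded:
  fixes B :: int
  assumes inj: "inj \<Psi>"
  shows "\<exists>k. (\<lambda>k k'. k' = \<Psi> k \<or> k' = bump i s (\<Psi> k))\<^sup>*\<^sup>* k0 k \<and> (\<exists>j r. B < \<bar>k j r\<bar>)"
proof (rule ccontr)
  let ?R = "\<lambda>k k'. k' = \<Psi> k \<or> k' = bump i s (\<Psi> k)"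
  define A where "A = {k. ?R\<^sup>*\<^sup>* k0 k}"
  assume neg: "\<not> ?thesis"
  have bdd: "\<bar>k j r\<bar> \<le> B" if "k \<in> A" for k j r
  proof (rule leI, rule notI)
    assume "B < \<bar>k j r\<bar>"
    then have "\<exists>j r. B < \<bar>k j r\<bar>" by (intro exI)
    with that have "\<exists>k. ?R\<^sup>*\<^sup>* k0 k \<and> (\<exists>j r. B < \<bar>k j r\<bar>)" unfolding A_def mem_Collect_eq by (intro exI[of _ k] conjI)
    with neg show False by (rule notE)
  qed
  have "A \<subseteq> (\<Pi>\<^sub>E j\<in>UNIV. \<Pi>\<^sub>E r\<in>UNIV. {- B..B})"
    unfolding PiE_UNIV_domain
  proof (intro subsetI Pi_I)
    fix k j r assume "k \<in> A"
    from bdd[OF this, of j r] show "k j r \<in> {- B..B}" by (simp add: abs_le_iff)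
  qed
  then have fin: "finite A"
    by (rule finite_subset[OF _ finite_PiE[OF finite finite_PiE[OF finite finite_atLeastAtMost_int]]])
  have step: "\<Psi> k \<in> A" "bump i s (\<Psi> k) \<in> A" if "k \<in> A" for k
    using rtranclp.rtrancl_into_rtrancl[of ?R k0 k] that unfolding A_def by simp_all
  have "\<Psi> ` A \<subseteq> A" by (rule image_subsetI) (rule step(1))
  then have "\<Psi> ` A = A" by (rule endo_inj_surj[OF fin _ inj_on_subset[OF inj subset_UNIV]])
  have bump_A: "bump i s k \<in> A" if "k \<in> A" for k
  proof -
    from that \<open>\<Psi> ` A = A\<close> obtain k' where "k = \<Psi> k'" "k' \<in> A" by (metis imageE)
    with step(2) show ?thesis by simp
  qed
  have k0: "k0 \<in> A" by (simp add: A_def)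
  have iter: "(bump i s ^^ n) k0 \<in> A" "(bump i s ^^ n) k0 i s = k0 i s + int n" for n
  proof -
    show "(bump i s ^^ n) k0 \<in> A" using k0 bump_A by (induction n) auto
    show "(bump i s ^^ n) k0 i s = k0 i s + int n" by (induction n) (auto simp: bump_def)
  qed
  have "k0 i s + int n \<le> B" for n
    using order_trans[OF abs_ge_self bdd[OF iter(1)[of n], of i s]] unfolding iter(2) .
  from this[of "nat (B - k0 i s + 1)"] show False by linarith
qed

text \<open>The base strategy has logit 0. A large positive entry at \<open>s\<close> therefore
  starves the base strategy \<open>b i\<close>, and a large negative one starves \<open>s\<close>
  itself. The bound \<open>m\<close> absorbs the initial probability in the denominator.\<close>

lemma pt_small:
  assumes k: "normalized k" and m: "0 < m" "\<And>i s. x $ i $ s \<noteq> 0 \<Longrightarrow> m \<le> x $ i $ s"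
    and big: "B < \<bar>k i s\<bar>" "0 \<le> B" and B: "exp (- (\<delta> * of_int B)) \<le> \<eta> * m"
  shows "\<exists>r. x $ i $ r \<noteq> 0 \<and> pt k $ i $ r \<le> \<eta>"
proof -
  let ?f = "\<lambda>r. x $ i $ r * exp (\<delta> * of_int (k i r))"
  have "x $ i $ r * exp (- (\<delta> * of_int B)) \<le> \<eta> * x $ i $ t" if "x $ i $ t \<noteq> 0" for r t
  proof -
    have "x $ i $ r * exp (- (\<delta> * of_int B)) \<le> 1 * (\<eta> * m)"
      using B mixed_profiles_le_1[OF x] mixed_profiles_nonneg[OF x] by (intro mult_mono) auto
    also have "\<dots> \<le> \<eta> * x $ i $ t"
    proof -
      have "0 < \<eta> * m" using B exp_gt_zero less_le_trans by blast
      then have "0 \<le> \<eta>" using m(1) by (simp add: zero_less_mult_iff)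
      then show ?thesis using m(2)[OF that] by (simp add: mult_left_mono)
    qed
    finally show ?thesis .
  qed note small = this
  have le: "pt k $ i $ r \<le> ?f r / ?f t" if "x $ i $ t \<noteq> 0" for r t
  proof -
    have t: "0 < ?f t" using that mixed_profiles_nonneg[OF x, of i t] by simp
    have "?f t \<le> (\<Sum>r\<in>UNIV. ?f r)"
      using mixed_profiles_nonneg[OF x] by (intro member_le_sum) auto
    with t show ?thesis
      unfolding pt_def reweight_nth using mixed_profiles_nonneg[OF x, of i r]
      by (intro divide_left_mono) (auto intro!: mult_pos_pos)
  qed
  have k0: "k i (b i) = 0" using k by (simp add: normalized_def)
  have pos: "0 < x $ i $ t" if "x $ i $ t \<noteq> 0" for t
    using that mixed_profiles_nonneg[OF x, of i t] by simp
  show ?thesis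
  proof (cases "k i s \<ge> 0")
    case True
    then have ks: "B \<le> k i s" and xs: "x $ i $ s \<noteq> 0"
      using big k by (auto simp: normalized_def)
    have "pt k $ i $ b i \<le> x $ i $ b i / ?f s" using le[OF xs, of "b i"] k0 by simp
    also have "\<dots> = x $ i $ b i * exp (- (\<delta> * of_int (k i s))) / x $ i $ s"
      by (simp add: exp_minus field_simps)
    also have "\<dots> \<le> x $ i $ b i * exp (- (\<delta> * of_int B)) / x $ i $ s"
      using ks \<delta> pos[OF xs] pos[OF b[of i]] by (intro divide_right_mono mult_left_mono) auto
    also have "\<dots> \<le> \<eta>" using small[OF xs, of "b i"] pos[OF xs] by (simp add: divide_le_eq)
    finally show ?thesis using b by blast
  next
    case False
    then have ks: "k i s \<le> - B" and xs: "x $ i $ s \<noteq> 0"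
      using big k by (auto simp: normalized_def)
    have "pt k $ i $ s \<le> ?f s / x $ i $ b i" using le[OF b[of i], of s] k0 by simp
    also have "\<dots> \<le> x $ i $ s * exp (- (\<delta> * of_int B)) / x $ i $ b i"
    proof -
      have "\<delta> * real_of_int (k i s) \<le> \<delta> * of_int (- B)" using ks \<delta> by (intro mult_left_mono) (auto simp only: of_int_le_iff)
      then show ?thesis using pos[OF xs] pos[OF b[of i]] by (intro divide_right_mono mult_left_mono) auto
    qed
    also have "\<dots> \<le> \<eta>" using small[OF b[of i], of s] pos[OF b[of i]] by (simp add: divide_le_eq)
    finally show ?thesis using xs by blast
  qed
qed

end

section \<open>Chains from mixed to pure profiles\<close>

text \<open>Chains allow any duration from T on, but all steps here last exactly T, so chains become
  iterates of one relation and can be concatenated freely.\<close>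

definition chain_step :: "'a::metric_space set \<Rightarrow> ('a \<Rightarrow> real \<Rightarrow> 'a) \<Rightarrow> real \<Rightarrow> real \<Rightarrow> 'a \<Rightarrow> 'a \<Rightarrow> bool"
  where "chain_step X \<phi> \<epsilon> T x y \<longleftrightarrow> x \<in> X \<and> y \<in> X \<and> dist (\<phi> x T) y < \<epsilon>"

lemma has_chainI:
  fixes n :: nat and c :: "nat \<Rightarrow> 'a::metric_space" and t :: "nat \<Rightarrow> real"
  assumes "2 \<le> n" "c 1 = x" "c n = y" "\<And>i. i \<in> {1..n} \<Longrightarrow> c i \<in> X"
    and "\<And>i. i \<in> {1..n - 1} \<Longrightarrow> T \<le> t i"
    and "\<And>i. i \<in> {1..n - 1} \<Longrightarrow> dist (\<phi> (c i) (t i)) (c (i + 1)) < \<epsilon>"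
  shows "has_chain X \<phi> \<epsilon> T x y"
  unfolding has_chain_def
  by (intro exI[where x = n] exI[where x = c] exI[where x = t] conjI ballI assms)

text \<open>A chain has at least two points, hence at least one step; this is why the transitive
  closure must not be reflexive.\<close>

lemma has_chain_tranclp:
  assumes "(chain_step X \<phi> \<epsilon> T)\<^sup>+\<^sup>+ x y"
  shows "has_chain X \<phi> \<epsilon> T x y"
  using assms
proof (induction rule: tranclp_induct)
  case (base y)
  have x: "x \<in> X" and y: "y \<in> X" and d: "dist (\<phi> x T) y < \<epsilon>"
    using base by (simp_all add: chain_step_def)
  show ?case
  proof (rule has_chainI[where n = 2 and c = "\<lambda>i. if i = 1 then x else y" and t = "\<lambda>_. T"])
    fix i :: nat assume "i \<in> {1..2 - 1}"
    then have "i = 1" by simp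
    with d show "dist (\<phi> (if i = 1 then x else y) T) (if i + 1 = 1 then x else y) < \<epsilon>" by simp
  qed (use x y in simp_all)
next
  case (step y z)
  from step.IH obtain n :: nat and c t where n: "2 \<le> n" and c: "c 1 = x" "c n = y" "\<forall>i\<in>{1..n}. c i \<in> X"
    and t: "\<forall>i\<in>{1..n - 1}. T \<le> t i \<and> dist (\<phi> (c i) (t i)) (c (i + 1)) < \<epsilon>"
    unfolding has_chain_def by (elim exE conjE)
  have yz: "z \<in> X" "dist (\<phi> y T) z < \<epsilon>" using step.hyps by (simp_all add: chain_step_def)
  show ?case
  proof (rule has_chainI[where n = "Suc n" and c = "c(Suc n := z)" and t = "t(n := T)"])
    fix i assume i: "i \<in> {1..Suc n - 1}"
    then have i': "i \<noteq> n \<Longrightarrow> i \<in> {1..n - 1}" by auto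
    show "T \<le> (t(n := T)) i" using bspec[OF t i'] by (cases "i = n") simp_all
    show "dist (\<phi> ((c(Suc n := z)) i) ((t(n := T)) i)) ((c(Suc n := z)) (i + 1)) < \<epsilon>"
      using bspec[OF t i'] i yz c(2) by (cases "i = n") simp_all
  next
    fix i assume "i \<in> {1..Suc n}"
    then show "(c(Suc n := z)) i \<in> X" using bspec[OF c(3), of i] yz by (cases "i = Suc n") simp_all
  qed (use n c in simp_all)
qed

text \<open>All the mass of \<open>s\<close> is moved to another strategy \<open>r\<close> in the
  support of the same player, which exists because \<open>s\<close> has probability below 1. The
  point stays in its closed face and moves by the mass times the distance of two unit vectors, at
  most 2.\<close>

lemma move_mass:
  assumes y: "y \<in> mixed_profiles S" and s: "y $ i $ s \<noteq> 0" "y $ i $ s < 1"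
  obtains z where "z \<in> mixed_profiles S" "z $ i $ s = 0"
    "\<And>j r. y $ j $ r = 0 \<Longrightarrow> z $ j $ r = 0" "dist y z \<le> 2 * y $ i $ s"
proof -
  let ?c = "y $ i $ s"
  have "(\<Sum>r\<in>UNIV - {s}. y $ i $ r) = 1 - ?c"
    using mixed_profiles_sum[OF y, of i] by (simp add: sum_diff1)
  then have "(\<Sum>r\<in>UNIV - {s}. y $ i $ r) \<noteq> 0" using s(2) by simp
  then obtain r where "r \<in> UNIV - {s}" "y $ i $ r \<noteq> 0"
    by (meson sum.not_neutral_contains_not_neutral)
  then have r: "r \<noteq> s" "y $ i $ r \<noteq> 0" by simp_all
  define z where "z = y - ?c *\<^sub>R axis i (axis s 1 - axis r 1)"
  have z: "z $ j $ t = y $ j $ t - (if j = i then (if t = s then ?c else if t = r then - ?c else 0) else 0)" for j t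
    using r by (auto simp: z_def axis_def)
  have nn: "0 \<le> ?c" using mixed_profiles_nonneg[OF y] .
  show ?thesis
  proof (rule that)
    show "z \<in> mixed_profiles S"
    proof (rule mixed_profilesI)
      show "0 \<le> z $ j $ t" for j t
        using mixed_profiles_nonneg[OF y, of j t] nn by (auto simp: z)
      show "z $ j $ t = 0" if "t \<notin> S j" for j t
        using mixed_profiles_outside[OF y that] mixed_profiles_outside[OF y, of r i] 
          mixed_profiles_outside[OF y, of s i] r s that by (auto simp: z)
      have "(\<Sum>t\<in>UNIV. axis s (1::real) $ t - axis r 1 $ t) = 0"
        by (simp add: sum_subtractf axis_def)
      then have "(\<Sum>t\<in>UNIV. ?c * (axis s (1::real) $ t - axis r 1 $ t)) = 0"
        by (simp flip: sum_distrib_left)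
      moreover have "(\<Sum>t\<in>UNIV. z $ j $ t) = (\<Sum>t\<in>UNIV. y $ j $ t)
          - (if j = i then \<Sum>t\<in>UNIV. ?c * (axis s 1 $ t - axis r 1 $ t) else 0)" for j
        unfolding z_def by (auto simp: axis_def[of i] sum_subtractf)
      ultimately show "(\<Sum>t\<in>UNIV. z $ j $ t) = 1" for j
        using mixed_profiles_sum[OF y, of j] by simp
    qed
    show "z $ i $ s = 0" by (simp add: z)
    show "z $ j $ t = 0" if "y $ j $ t = 0" for j t
      using that r s by (auto simp: z)
    have "dist y z = ?c * norm (axis s (1::real) - axis r 1)"
      using nn by (simp add: dist_norm z_def norm_axis)
    also have "\<dots> \<le> ?c * (norm (axis s (1::real)) + norm (axis r (1::real)))"
      using nn by (intro mult_left_mono norm_triangle_ineq4)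
    finally show "dist y z \<le> 2 * ?c" by (simp add: norm_axis)
  qed
qed

section \<open>Passing to a smaller face\<close>

definition support :: "real ^ 's ^ 'n \<Rightarrow> ('n \<times> 's) set"
  where "support x = {(i, s). x $ i $ s \<noteq> 0}"

lemma inj_fold:
  assumes "\<And>i. inj (f i)"
  shows "inj (fold f ps)"
  using assms by (induction ps) (auto intro: inj_compose)

lemma support_min:
  fixes x :: "real ^ 's::finite ^ 'n::finite"
  assumes x: "x \<in> mixed_profiles S"
  obtains m where "0 < m" "\<And>i s. x $ i $ s \<noteq> 0 \<Longrightarrow> m \<le> x $ i $ s"
proof -
  let ?P = "insert 1 ((\<lambda>(i, s). x $ i $ s) ` support x)"
  have fin: "finite ?P" by simp
  have "0 < Min ?P"
    using mixed_profiles_nonneg[OF x] by (subst Min_gr_iff[OF fin]) (auto simp: support_def less_le)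
  moreover have "Min ?P \<le> x $ i $ s" if "x $ i $ s \<noteq> 0" for i s
    using that by (intro Min_le[OF fin]) (force simp: support_def)
  ultimately show ?thesis by (rule that)
qed

text \<open>The step has to divide T exactly, because n sweeps must add up to one chain step of
  duration T.\<close>

lemma small_step_size:
  fixes T K \<epsilon> :: real
  assumes "0 < T" "0 \<le> K" "0 < \<epsilon>"
  obtains n :: nat and h :: real where "0 < h" "h \<le> 1" "real n * h = T" "K * h < \<epsilon>"
proof -
  obtain n :: nat where n: "max T (T * K / \<epsilon>) < real n" using reals_Archimedean2 by blast
  then have n0: "0 < real n" using assms(1) by linarith
  have "T * K < \<epsilon> * real n" using n assms(3) by (simp add: divide_less_eq mult.commute)
  then show ?thesis
    using n n0 assms by (intro that[of "T / real n" n]) (auto simp: field_simps)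
qed

text \<open>The parameters are fixed in the order h, \<delta>, B: the step from \<epsilon> and T,
  the mesh from the step, the escape radius from the mesh. The strict decrease of the support is
  what drives the induction down to a vertex.\<close>

lemma reach_boundary:
  fixes S :: "'n::finite \<Rightarrow> 's::finite set"
  assumes lip: "lipschitz_field (replicator_field S u) (mixed_profiles S) L"
    and M: "0 \<le> M" "\<And>y. y \<in> mixed_profiles S \<Longrightarrow> norm (replicator_field S u y) \<le> M"
    and fl: "is_flow_of (replicator_field S u) (mixed_profiles S) \<phi>"
    and x: "x \<in> mixed_profiles S" and mixed: "x $ i0 $ s0 \<noteq> 0" "x $ i0 $ b0 \<noteq> 0" "s0 \<noteq> b0"
    and \<epsilon>: "0 < \<epsilon>" and T: "0 < T"
  obtains z where "z \<in> mixed_profiles S" "support z \<subset> support x"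
    "(chain_step (mixed_profiles S) \<phi> \<epsilon> T)\<^sup>*\<^sup>* x z"
proof -
  let ?X = "mixed_profiles S" and ?N = "real CARD('n)"
  have L: "0 \<le> L" using lip by (simp add: lipschitz_field_def)
  have "\<exists>s. x $ i $ s \<noteq> 0" for i
    using mixed_profiles_support[OF x] by blast
  then obtain b' where b': "\<And>i. x $ i $ b' i \<noteq> 0" by metis
  \<comment> \<open>Taking \<open>b0\<close> as base of player \<open>i0\<close> makes
    \<open>s0\<close> a non-base strategy, so that \<open>bump i0 s0\<close> preserves
    normalization.\<close>
  define b where "b = b'(i0 := b0)"
  have b: "x $ i $ b i \<noteq> 0" for i using b' mixed by (simp add: b_def)
  \<comment> \<open>The error of \<open>sweep_error\<close> with \<open>mesh\<close> equal to h^2,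
    divided by h^2 and estimated using \<open>h \<le> 1\<close>. The extra 1 in the factor of h
    below pays for the bump, which moves a point by at most
    \<open>h\<^sup>2 \<le> h\<close>.\<close>
  define C where "C = L * M + ?N * (L * M + 1) + L * (M + 1) * ?N\<^sup>2"
  have C: "0 \<le> C" using L M by (simp add: C_def)
  have "0 \<le> C * T * exp (L * T) + 1" "0 < \<epsilon> / 2" using C T \<epsilon> by simp_all
  from small_step_size[OF T this]
  obtain n h where step_size: "0 < h" "h \<le> 1" "real n * h = T" "(C * T * exp (L * T) + 1) * h < \<epsilon> / 2"
    by blast
  \<comment> \<open>Solves \<open>mesh = h\<^sup>2\<close>, which puts rounding on the order of the
    local error of a sweep.\<close>
  define \<delta> where "\<delta> = ln (1 + h\<^sup>2 / ?N)"
  have "0 < h\<^sup>2 / ?N" using step_size by simp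
  then have mesh_size: "0 < \<delta>" "exp \<delta> = 1 + h\<^sup>2 / ?N" unfolding \<delta>_def by (auto intro: ln_gt_zero)
  interpret logit_lattice S u x b \<delta> h
    by unfold_locales (use x b mesh_size step_size in auto)
  have mesh: "mesh = h\<^sup>2" by (simp add: mesh_def mesh_size)
  obtain ps :: "'n list" where ps: "distinct ps" "set ps = UNIV"
    using finite_distinct_list[of "UNIV :: 'n set"] by auto
  define \<Psi> where "\<Psi> = fold shear ps ^^ n"
  have inj: "inj \<Psi>" unfolding \<Psi>_def by (intro inj_fn inj_fold inj_shear)
  have norm_fold: "normalized k \<Longrightarrow> normalized (fold shear qs k)" for k qs
    by (induction qs arbitrary: k) (auto intro: normalized_shear)
  have norm_\<Psi>: "normalized k \<Longrightarrow> normalized (\<Psi> k)" for k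
    unfolding \<Psi>_def by (induction n) (auto intro: norm_fold)
  let ?R = "\<lambda>k k'. k' = \<Psi> k \<or> k' = bump i0 s0 (\<Psi> k)"
  have h2: "h\<^sup>2 \<le> h" using step_size by (simp add: power2_eq_square mult_left_le)
  have loc: "dist (\<phi> (pt k) h) (pt (fold shear ps k)) \<le> C * h\<^sup>2" for k
  proof -
    have "h * L * (M * h + h\<^sup>2) * ?N\<^sup>2 \<le> h * L * (M * h + h) * ?N\<^sup>2"
      using step_size h2 L by (intro mult_right_mono mult_left_mono) auto
    also have "\<dots> = L * (M + 1) * ?N\<^sup>2 * h\<^sup>2" by (simp add: power2_eq_square algebra_simps)
    finally have "L * M * h\<^sup>2 + (?N * (L * M * h\<^sup>2 + h\<^sup>2) + h * L * (M * h + h\<^sup>2) * ?N\<^sup>2) \<le> C * h\<^sup>2"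
      by (simp add: C_def algebra_simps)
    with sweep_error[OF lip M(2) fl ps, of k] show ?thesis unfolding mesh by linarith
  qed
  have glob: "dist (\<phi> (pt k) T) (pt (\<Psi> k)) \<le> C * T * exp (L * T) * h" for k
  proof -
    have "dist (\<phi> (pt k) (real n * h)) (pt (\<Psi> k)) \<le> real n * (C * h\<^sup>2) * exp (L * (real n * h))"
      unfolding \<Psi>_def 
      by (rule one_step_method_error[where e = pt, OF lip fl]) (use pt_in loc step_size(1) in auto)
    also have "real n * (C * h\<^sup>2) = C * (real n * h) * h" by (simp add: power2_eq_square)
    finally show ?thesis unfolding step_size(3) by (simp only: mult_ac)
  qed
  have near: "dist (\<phi> (pt k) T) (pt k') < \<epsilon> / 2" if "?R k k'" for k k'
  proof -
    have "dist (pt (\<Psi> k)) (pt k') \<le> h"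
      using that bump_dist[of i0 s0 "\<Psi> k"] step_size h2 by (auto simp: mesh dist_norm norm_minus_commute)
    with glob[of k] have "dist (\<phi> (pt k) T) (pt k') \<le> C * T * exp (L * T) * h + h"
      by (rule order_trans[OF dist_triangle add_mono])
    also have "\<dots> = (C * T * exp (L * T) + 1) * h" by (simp add: distrib_right)
    also have "\<dots> < \<epsilon> / 2" by (rule step_size(4))
    finally show ?thesis .
  qed
  obtain m where m: "0 < m" "\<And>i s. x $ i $ s \<noteq> 0 \<Longrightarrow> m \<le> x $ i $ s"
    using support_min[OF x] by blast
  \<comment> \<open>With \<open>\<epsilon> / 4\<close> the removal of the mass costs at most
    \<open>\<epsilon> / 2\<close>, the share left over by \<open>near\<close>; with
    \<open>1 / 2\<close> the strategy removed has probability below 1, as \<open>move_mass\<close>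
    demands.\<close>
  define \<eta> where "\<eta> = min (\<epsilon> / 4) (1 / 2)"
  have \<eta>: "0 < \<eta>" "\<eta> < 1" "2 * \<eta> \<le> \<epsilon> / 2" using \<epsilon> by (auto simp: \<eta>_def)
  \<comment> \<open>Obtained by solving \<open>exp (- (\<delta> * B)) \<le> \<eta> * m\<close>.
    Being nonnegative, B also ensures that the escaping lattice point is not the origin.\<close>
  define B where "B = max 0 \<lceil>- ln (\<eta> * m) / \<delta>\<rceil>"
  have B0: "0 \<le> B" by (simp add: B_def)
  have B: "exp (- (\<delta> * of_int B)) \<le> \<eta> * m"
  proof -
    have "- ln (\<eta> * m) / \<delta> \<le> of_int B" unfolding B_def by linarith
    then have "- (\<delta> * of_int B) \<le> ln (\<eta> * m)" using mesh_size(1) by (simp add: field_simps)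
    then have "exp (- (\<delta> * of_int B)) \<le> exp (ln (\<eta> * m))" by (simp only: exp_le_cancel_iff)
    also have "\<dots> = \<eta> * m" using m(1) \<eta>(1) by simp
    finally show ?thesis .
  qed
  let ?k0 = "\<lambda>i s. 0 :: int"
  obtain k j r where k: "?R\<^sup>*\<^sup>* ?k0 k" and big: "B < \<bar>k j r\<bar>"
    using orbit_unbounded[OF inj, of i0 s0 ?k0 B] by (elim exE conjE)
  have norm_R: "normalized k" if "?R\<^sup>*\<^sup>* ?k0 k" for k
    using that
  proof (induction rule: rtranclp_induct)
    case base
    show ?case by (simp add: normalized_def)
  next
    case (step k k')
    have "s0 \<noteq> b i0" using mixed by (simp add: b_def)
    with norm_\<Psi>[OF step.IH] have "normalized (\<Psi> k)" "normalized (bump i0 s0 (\<Psi> k))"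
      using normalized_bump mixed(1) by auto
    with step.hyps(2) show ?case by (elim disjE) simp_all
  qed
  have chain_R: "(chain_step ?X \<phi> \<epsilon> T)\<^sup>*\<^sup>* x (pt k)" if "?R\<^sup>*\<^sup>* ?k0 k" for k
    using that
  proof (induction rule: rtranclp_induct)
    case base
    show ?case by (simp add: pt_0)
  next
    case (step k k')
    from \<open>?R k k'\<close> have "dist (\<phi> (pt k) T) (pt k') < \<epsilon> / 2" by (rule near)
    then have "chain_step ?X \<phi> \<epsilon> T (pt k) (pt k')"
      using \<epsilon> pt_in by (simp add: chain_step_def)
    with step.IH show ?case by (rule rtranclp.rtrancl_into_rtrancl)
  qed
  \<comment> \<open>The jump to the boundary takes no flow time, so it is merged into the last step
    leading to \<open>pt k\<close>. Such a step exists because \<open>k\<close> is not the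
    origin.\<close>
  have "k \<noteq> ?k0"
  proof
    assume "k = ?k0"
    with big B0 show False by simp
  qed
  from k obtain k1 where k1: "?R\<^sup>*\<^sup>* ?k0 k1" "?R k1 k"
  proof (cases rule: rtranclp.cases)
    case rtrancl_refl
    with \<open>k \<noteq> ?k0\<close> show ?thesis by simp
  next
    case (rtrancl_into_rtrancl k1)
    then show ?thesis by (intro that)
  qed
  obtain r where r: "x $ j $ r \<noteq> 0" "pt k $ j $ r \<le> \<eta>"
    using pt_small[OF norm_R[OF k] m big B0 B] by blast
  have "pt k $ j $ r \<noteq> 0" "pt k $ j $ r < 1" using r \<eta> by (auto simp: pt_eq_0_iff)
  from move_mass[OF pt_in this]
  obtain z where z: "z \<in> ?X" "z $ j $ r = 0" "\<And>j r. pt k $ j $ r = 0 \<Longrightarrow> z $ j $ r = 0"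
    "dist (pt k) z \<le> 2 * pt k $ j $ r" by blast
  show ?thesis
  proof (rule that[OF z(1)])
    have "support z \<subseteq> support x" using z(3) by (auto simp: support_def pt_eq_0_iff)
    moreover have "(j, r) \<in> support x - support z" using r z(2) by (simp add: support_def)
    ultimately show "support z \<subset> support x" by blast
    have "dist (\<phi> (pt k1) T) z \<le> dist (\<phi> (pt k1) T) (pt k) + dist (pt k) z"
      by (rule dist_triangle)
    also have "\<dots> < \<epsilon>" using near[OF k1(2)] z(4) r(2) \<eta>(3) by linarith
    finally have "chain_step ?X \<phi> \<epsilon> T (pt k1) z" using z(1) pt_in by (simp add: chain_step_def)
    with chain_R[OF k1(1)] show "(chain_step ?X \<phi> \<epsilon> T)\<^sup>*\<^sup>* x z"
      by (rule rtranclp.rtrancl_into_rtrancl)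
  qed
qed

definition vertex :: "('n \<Rightarrow> 's) \<Rightarrow> real ^ 's ^ 'n"
  where "vertex p = (\<chi> i. axis (p i) 1)"

lemma pure_eq_vertex:
  assumes x: "x \<in> mixed_profiles S" and pure: "\<And>i s t. x $ i $ s \<noteq> 0 \<Longrightarrow> x $ i $ t \<noteq> 0 \<Longrightarrow> s = t"
  obtains p where "p \<in> profiles S" "x = vertex p"
proof -
  have "\<exists>s. x $ i $ s \<noteq> 0" for i
    using mixed_profiles_support[OF x] by blast
  then obtain p where p: "\<And>i. x $ i $ p i \<noteq> 0" by metis
  have 0: "x $ i $ s = 0" if "s \<noteq> p i" for i s using pure p that by blast
  have 1: "x $ i $ p i = 1" for i
    using mixed_profiles_sum[OF x, of i] sum.remove[of UNIV "p i" "\<lambda>s. x $ i $ s"] 0 by simp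
  show ?thesis
  proof (rule that)
    show "p \<in> profiles S" using p mixed_profiles_outside[OF x] by (auto simp: profiles_def)
    show "x = vertex p" by (auto simp: vec_eq_iff vertex_def axis_def 0 1)
  qed
qed

lemma reach_vertex:
  fixes S :: "'n::finite \<Rightarrow> 's::finite set"
  assumes fl: "is_flow_of (replicator_field S u) (mixed_profiles S) \<phi>"
    and x: "x \<in> mixed_profiles S" and \<epsilon>: "0 < \<epsilon>" and T: "0 < T"
  shows "\<exists>p\<in>profiles S. (chain_step (mixed_profiles S) \<phi> \<epsilon> T)\<^sup>*\<^sup>* x (vertex p)"
proof -
  obtain L M where lip: "lipschitz_field (replicator_field S u) (mixed_profiles S) L" and M: "0 \<le> M"
    "\<And>x. x \<in> mixed_profiles S \<Longrightarrow> norm (replicator_field S u x) \<le> M"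
    using replicator_field_lipschitz by blast
  show ?thesis
    using x
  proof (induction "card (support x)" arbitrary: x rule: less_induct)
    case less
    show ?case
    proof (cases "\<exists>i s t. x $ i $ s \<noteq> 0 \<and> x $ i $ t \<noteq> 0 \<and> s \<noteq> t")
      case True
      then obtain i s t where "x $ i $ s \<noteq> 0" "x $ i $ t \<noteq> 0" "s \<noteq> t" by blast
      from reach_boundary[OF lip M fl less.prems this \<epsilon> T]
      obtain z where z: "z \<in> mixed_profiles S" "support z \<subset> support x"
        "(chain_step (mixed_profiles S) \<phi> \<epsilon> T)\<^sup>*\<^sup>* x z" by blast
      have "card (support z) < card (support x)" using z(2) by (intro psubset_card_mono) auto
      from less.hyps[OF this z(1)] z(3) show ?thesis by (meson rtranclp_trans)
    next
      case False
      then obtain p where "p \<in> profiles S" "x = vertex p" using pure_eq_vertex[OF less.prems] by metis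
      then show ?thesis by blast
    qed
  qed
qed

text \<open>A backward step misses its target by less than \<open>\<epsilon> / exp (L * T)\<close>.
  Flowing forward for time T expands this gap by a factor of at most
  \<open>exp (L * T)\<close>.\<close>

lemma chain_step_reverse:
  fixes F :: "'a::real_inner \<Rightarrow> 'a"
  assumes lip: "lipschitz_field F X L" and fl: "is_flow_of F X \<phi>" and T: "0 \<le> T"
    and step: "chain_step X (\<lambda>x t. \<phi> x (- t)) (\<epsilon> / exp (L * T)) T x y"
  shows "chain_step X \<phi> \<epsilon> T y x"
proof -
  have x: "x \<in> X" and y: "y \<in> X" and d: "dist (\<phi> x (- T)) y < \<epsilon> / exp (L * T)"
    using step by (simp_all add: chain_step_def)
  have past: "\<phi> x (- T) \<in> X" using fl x by (simp add: is_flow_of_def)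
  have "\<phi> (\<phi> x (- T)) T = x"
    using flow_add[OF lip fl x, of "- T" T] fl x by (simp add: is_flow_of_def)
  then have "dist (\<phi> y T) x \<le> exp (L * T) * dist y (\<phi> x (- T))"
    using flow_dist_le[OF lip fl y past T] by simp
  also have "\<dots> < \<epsilon>" using d by (simp add: field_simps dist_commute)
  finally show ?thesis using x y by (simp add: chain_step_def)
qed

lemma chain_steps_reverse:
  fixes F :: "'a::real_inner \<Rightarrow> 'a"
  assumes "lipschitz_field F X L" "is_flow_of F X \<phi>" "0 \<le> T"
    and "(chain_step X (\<lambda>x t. \<phi> x (- t)) (\<epsilon> / exp (L * T)) T)\<^sup>*\<^sup>* x y"
  shows "(chain_step X \<phi> \<epsilon> T)\<^sup>*\<^sup>* y x"
  using assms(4)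
proof (induction rule: rtranclp_induct)
  case (step y z)
  show ?case
    by (rule converse_rtranclp_into_rtranclp[OF chain_step_reverse[OF assms(1-3) step.hyps(2)] step.IH])
qed simp

text \<open>\<open>reach_vertex\<close> holds for every utility function, in particular for the
  negated one, whose flow is \<phi> run backwards. The chain found there is then turned
  around.\<close>

lemma reach_from_vertex:
  fixes S :: "'n::finite \<Rightarrow> 's::finite set"
  assumes fl: "is_flow_of (replicator_field S u) (mixed_profiles S) \<phi>"
    and x: "x \<in> mixed_profiles S" and \<epsilon>: "0 < \<epsilon>" and T: "0 < T"
  shows "\<exists>p\<in>profiles S. (chain_step (mixed_profiles S) \<phi> \<epsilon> T)\<^sup>*\<^sup>* (vertex p) x"
proof -
  obtain L M where lip: "lipschitz_field (replicator_field S u) (mixed_profiles S) L"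
    using replicator_field_lipschitz by blast
  have rev: "is_flow_of (replicator_field S (\<lambda>q. - u q)) (mixed_profiles S) (\<lambda>x t. \<phi> x (- t))"
    using flow_reverse[OF fl] unfolding replicator_field_minus .
  have "0 < \<epsilon> / exp (L * T)" using \<epsilon> by simp
  from reach_vertex[OF rev x this T] obtain p where p: "p \<in> profiles S"
    "(chain_step (mixed_profiles S) (\<lambda>x t. \<phi> x (- t)) (\<epsilon> / exp (L * T)) T)\<^sup>*\<^sup>* x (vertex p)"
    by (elim bexE)
  from chain_steps_reverse[OF lip fl less_imp_le[OF T] p(2)] p(1) show ?thesis by (rule bexI)
qed

section \<open>Chains between pure profiles\<close>

lemma strategy_utility_vertex:
  assumes p: "p \<in> profiles S" and s: "s \<in> S i"
  shows "strategy_utility S u i s (vertex p) = u (p(i := s)) $ i"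
proof -
  have "(\<Prod>j\<in>UNIV. (if j = i then axis s (1::real) $ q j else vertex p $ j $ q j)) = (if q = p(i := s) then 1 else 0)" for q
  proof (cases "q = p(i := s)")
    case True
    then show ?thesis by (intro trans[OF prod.neutral]) (auto simp: vertex_def axis_def)
  next
    case False
    then obtain j where "q j \<noteq> (p(i := s)) j" by blast
    then have "(if j = i then axis s (1::real) $ q j else vertex p $ j $ q j) = 0"
      by (cases "j = i") (simp_all add: vertex_def axis_def)
    then have "\<exists>j\<in>UNIV. (if j = i then axis s (1::real) $ q j else vertex p $ j $ q j) = 0"
      by (rule bexI[where x = j]) (rule UNIV_I)
    from prod_zero[OF finite this] False show ?thesis by simp
  qed
  then have "strategy_utility S u i s (vertex p) = (\<Sum>q\<in>profiles S. if q = p(i := s) then u q $ i else 0)"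
    unfolding strategy_utility_eq by (intro sum.cong) auto
  also have "\<dots> = u (p(i := s)) $ i"
    using p s by (subst sum.delta) (auto simp: profiles_def)
  finally show ?thesis .
qed

lemma integral_curve_cong:
  assumes "integral_curve F X z" "\<And>t. F (z t) = G (z t)"
  shows "integral_curve G X z"
  using assms(1) unfolding integral_curve_def assms(2) .

text \<open>A player using a pure strategy does not move. If all players but i are pure, the
  closed-form motion of player i is thus the full flow.\<close>

lemma player_field_eq:
  assumes x: "x \<in> mixed_profiles S" and pure: "\<And>j. j \<noteq> i \<Longrightarrow> x $ j = axis (p j) 1"
  shows "player_field S u i x = replicator_field S u x"
proof -
  have "replicator_field S u x $ j $ s = 0" if "j \<noteq> i" for j s
  proof -
    have "(\<Sum>t\<in>UNIV. x $ j $ t * f t) = f (p j)" for f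
      by (subst sum.remove[of UNIV "p j"]) (auto simp: pure[OF that] axis_def intro!: sum.neutral)
    then show ?thesis
      by (simp add: replicator_field_def sum_mixed_profile[OF x]) (simp add: pure[OF that] axis_def)
  qed
  then show ?thesis by (auto simp: player_field_def axis_def vec_eq_iff)
qed

section \<open>The flow on the edge between two comparable pure profiles\<close>

definition edge_point :: "'n::finite \<Rightarrow> ('n \<Rightarrow> 's::finite) \<Rightarrow> ('n \<Rightarrow> 's) \<Rightarrow> real \<Rightarrow> real ^ 's ^ 'n"
  where "edge_point i p q \<theta> =
    (\<chi> j. if j = i then (1 - \<theta>) *\<^sub>R axis (p i) 1 + \<theta> *\<^sub>R axis (q i) 1 else axis (p j) 1)"

lemma edge_point_in:
  fixes p q :: "'n::finite \<Rightarrow> 's::finite"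
  assumes "p \<in> profiles S" "q \<in> profiles S" "0 \<le> \<theta>" "\<theta> \<le> 1"
  shows "edge_point i p q \<theta> \<in> mixed_profiles S"
proof (rule mixed_profilesI)
  show "0 \<le> edge_point i p q \<theta> $ j $ s" for j s
    using assms(3,4) by (simp add: edge_point_def axis_def)
  show "edge_point i p q \<theta> $ j $ s = 0" if "s \<notin> S j" for j s
  proof -
    have "s \<noteq> p j" "s \<noteq> q j" using assms(1,2) that by (auto simp: profiles_def)
    then show ?thesis by (cases "j = i") (simp_all add: edge_point_def axis_def)
  qed
  have 1: "(\<Sum>s\<in>UNIV. axis r (1::real) $ s) = 1" for r :: 's by (simp add: axis_def)
  show "(\<Sum>s\<in>UNIV. edge_point i p q \<theta> $ j $ s) = 1" for j
  proof (cases "j = i")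
    case True
    then have "(\<Sum>s\<in>UNIV. edge_point i p q \<theta> $ j $ s)
        = (1 - \<theta>) * (\<Sum>s\<in>UNIV. axis (p i) 1 $ s) + \<theta> * (\<Sum>s\<in>UNIV. axis (q i) 1 $ s)"
      unfolding sum_distrib_left sum.distrib[symmetric] by (simp add: edge_point_def)
    then show ?thesis unfolding 1 by simp
  next
    case False
    then show ?thesis using 1 by (simp add: edge_point_def)
  qed
qed

lemma edge_point_dist: "dist (edge_point i p q a) (edge_point i p q b) \<le> 2 * \<bar>a - b\<bar>"
proof -
  have "edge_point i p q a - edge_point i p q b = (b - a) *\<^sub>R axis i (axis (p i) 1 - axis (q i) 1)"
    by (simp add: vec_eq_iff edge_point_def axis_def algebra_simps)
  then have "dist (edge_point i p q a) (edge_point i p q b)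
      = \<bar>a - b\<bar> * norm (axis (p i) (1::real) - axis (q i) 1)"
    by (simp add: dist_norm norm_axis abs_minus_commute)
  also have "\<dots> \<le> \<bar>a - b\<bar> * (norm (axis (p i) (1::real)) + norm (axis (q i) (1::real)))"
    by (intro mult_left_mono norm_triangle_ineq4) simp
  finally show ?thesis by (simp add: norm_axis)
qed

text \<open>The odds of \<open>q i\<close> against \<open>p i\<close> are multiplied by
  \<open>exp (t * (u q $ i - u p $ i))\<close>, which is at least 1. In terms of \<open>a\<close>,
  \<open>b\<close> and \<open>Z\<close> below, \<open>Z\<close> is an average of
  \<open>a \<le> b\<close>, so the factor \<open>b / Z\<close> is at least 1. In case of a tie every
  point of the edge is at rest.\<close>

lemma edge_flow:
  fixes S :: "'n::finite \<Rightarrow> 's::finite set"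
  assumes fl: "is_flow_of (replicator_field S u) (mixed_profiles S) \<phi>"
    and p: "p \<in> profiles S" and q: "q \<in> profiles S"
    and comp: "comparable i p q" and le: "u p $ i \<le> u q $ i"
    and \<theta>: "0 \<le> \<theta>" "\<theta> \<le> 1" and t: "0 \<le> t"
  shows "\<exists>\<theta>'\<ge>\<theta>. \<theta>' \<le> 1 \<and> \<phi> (edge_point i p q \<theta>) t = edge_point i p q \<theta>'"
proof -
  let ?X = "mixed_profiles S" and ?e = "edge_point i p q \<theta>"
  let ?w = "\<lambda>t j s. if j = i then exp (t * strategy_utility S u i s ?e) else 1"
  obtain L M where lip: "lipschitz_field (replicator_field S u) ?X L"
    using replicator_field_lipschitz by blast
  have e: "?e \<in> ?X" by (rule edge_point_in[OF p q \<theta>])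
  have ne: "p i \<noteq> q i" and q_eq: "p(i := q i) = q" using comp by (auto simp: comparable_def)
  have V: "strategy_utility S u i s ?e = strategy_utility S u i s (vertex p)" for s
    by (rule strategy_utility_cong) (simp add: edge_point_def vertex_def)
  have Vp: "strategy_utility S u i (p i) ?e = u p $ i"
    using strategy_utility_vertex[OF p, of "p i" i u] p by (simp add: V profiles_def)
  have Vq: "strategy_utility S u i (q i) ?e = u q $ i"
    using strategy_utility_vertex[OF p, of "q i" i u] q by (simp add: V profiles_def q_eq)
  have curve: "integral_curve (player_field S u i) ?X (\<lambda>t. reweight (?w t) ?e)"
    by (rule player_curve[OF e])
  have "player_field S u i (reweight (?w t) ?e) = replicator_field S u (reweight (?w t) ?e)" for t
  proof (rule player_field_eq[OF integral_curve_in[OF curve]])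
    show "reweight (?w t) ?e $ j = axis (p j) 1" if "j \<noteq> i" for j
      using that by (subst reweight_const[OF e]) (auto simp: edge_point_def)
  qed
  from integral_curve_cong[OF curve this]
  have rw: "integral_curve (replicator_field S u) ?X (\<lambda>t. reweight (?w t) ?e)" .
  have fle: "integral_curve (replicator_field S u) ?X (\<phi> ?e)" "\<phi> ?e 0 = ?e"
    using bspec[OF fl[unfolded is_flow_of_iff] e] by simp_all
  have "reweight (?w 0) ?e = ?e"
    by (simp add: vec_eq_iff reweight_nth mixed_profiles_sum[OF e] cong: if_cong)
  with fle(2) have "\<phi> ?e 0 = reweight (?w 0) ?e" by (rule trans[OF _ sym])
  from integral_curve_unique[OF lip fle(1) rw this]
  have flow: "\<phi> ?e t = reweight (?w t) ?e" .
  define a where "a = exp (t * u p $ i)"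
  define b where "b = exp (t * u q $ i)"
  define Z where "Z = (1 - \<theta>) * a + \<theta> * b"
  have a: "0 < a" and ab: "a \<le> b" using t le by (auto simp: a_def b_def mult_left_mono)
  have "a = (1 - \<theta>) * a + \<theta> * a" by (simp add: algebra_simps)
  also have "\<dots> \<le> Z" unfolding Z_def using \<theta> ab by (intro add_left_mono mult_left_mono) auto
  finally have Z: "0 < Z" using a by linarith
  have "Z \<le> (1 - \<theta>) * b + \<theta> * b" unfolding Z_def using \<theta> ab by (intro add_right_mono mult_left_mono) auto
  then have Zb: "Z \<le> b" by (simp add: algebra_simps)
  define \<theta>' where "\<theta>' = \<theta> * b / Z"
  have "\<theta> * Z \<le> \<theta> * b" using Zb \<theta> by (intro mult_left_mono)
  then have "\<theta> \<le> \<theta>'" using Z by (simp add: \<theta>'_def le_divide_eq)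
  moreover have "0 \<le> (1 - \<theta>) * a" using a \<theta> by simp
  then have "\<theta>' \<le> 1" using Z by (simp add: \<theta>'_def divide_le_eq) (simp add: Z_def)
  moreover have "reweight (?w t) ?e = edge_point i p q \<theta>'"
  proof -
    have ei: "?e $ i $ s = (if s = p i then 1 - \<theta> else if s = q i then \<theta> else 0)" for s
      using ne by (simp add: edge_point_def axis_def)
    have wi: "?e $ i $ s * ?w t i s = (if s = p i then (1 - \<theta>) * a else 0) + (if s = q i then \<theta> * b else 0)" for s
      using ne by (simp add: ei Vp Vq a_def b_def)
    have den: "(\<Sum>s\<in>UNIV. ?e $ i $ s * ?w t i s) = Z"
      unfolding wi by (simp add: sum.distrib Z_def)
    have "1 - \<theta>' = (Z - \<theta> * b) / Z" using Z by (simp add: \<theta>'_def diff_divide_distrib)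
    then have "1 - \<theta>' = (1 - \<theta>) * a / Z" by (simp add: Z_def)
    then have ri: "reweight (?w t) ?e $ i $ s = edge_point i p q \<theta>' $ i $ s" for s
      unfolding reweight_nth den unfolding wi using ne
      by (simp add: edge_point_def axis_def \<theta>'_def)
    have "reweight (?w t) ?e $ j $ s = edge_point i p q \<theta>' $ j $ s" for j s
    proof (cases "j = i")
      case True
      then show ?thesis using ri by (simp only:)
    next
      case False
      then show ?thesis by (subst reweight_const[OF e]) (auto simp: edge_point_def)
    qed
    then show ?thesis unfolding vec_eq_iff by blast
  qed
  ultimately show ?thesis unfolding flow by blast
qed

text \<open>The flow never loses ground but may stall, at the vertex \<open>p\<close> and on the
  whole edge in case of a tie. Progress therefore comes from the jumps: each adds
  \<open>\<epsilon> / 4\<close> to \<theta>, which by \<open>edge_point_dist\<close> is a distance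
  of at most \<open>\<epsilon> / 2\<close>, until \<theta> is capped at 1.\<close>

lemma reach_arc:
  fixes S :: "'n::finite \<Rightarrow> 's::finite set"
  assumes fl: "is_flow_of (replicator_field S u) (mixed_profiles S) \<phi>"
    and p: "p \<in> profiles S" and q: "q \<in> profiles S"
    and comp: "comparable i p q" and le: "u p $ i \<le> u q $ i" and \<epsilon>: "0 < \<epsilon>" and T: "0 < T"
  shows "(chain_step (mixed_profiles S) \<phi> \<epsilon> T)\<^sup>*\<^sup>* (vertex p) (vertex q)"
proof -
  let ?e = "edge_point i p q" and ?C = "chain_step (mixed_profiles S) \<phi> \<epsilon> T"
  have walk: "\<exists>\<theta>. min 1 (real n * (\<epsilon> / 4)) \<le> \<theta> \<and> \<theta> \<le> 1 \<and> ?C\<^sup>*\<^sup>* (?e 0) (?e \<theta>)" for n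
  proof (induction n)
    case 0
    show ?case by (rule exI[of _ 0]) simp
  next
    case (Suc n)
    then obtain \<theta> where \<theta>: "min 1 (real n * (\<epsilon> / 4)) \<le> \<theta>" "\<theta> \<le> 1" "?C\<^sup>*\<^sup>* (?e 0) (?e \<theta>)" by blast
    have "0 \<le> min 1 (real n * (\<epsilon> / 4))" using \<epsilon> by simp
    then have \<theta>0: "0 \<le> \<theta>" using \<theta>(1) by linarith
    obtain \<theta>' where \<theta>': "\<theta> \<le> \<theta>'" "\<theta>' \<le> 1" "\<phi> (?e \<theta>) T = ?e \<theta>'"
      using edge_flow[OF fl p q comp le \<theta>0 \<theta>(2) less_imp_le[OF T]] by blast
    define \<theta>'' where "\<theta>'' = min 1 (\<theta>' + \<epsilon> / 4)"
    have "\<bar>\<theta>' - \<theta>''\<bar> \<le> \<epsilon> / 4" using \<theta>'(2) \<epsilon> by (auto simp: \<theta>''_def min_def)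
    then have "dist (?e \<theta>') (?e \<theta>'') \<le> 2 * (\<epsilon> / 4)"
      by (intro order_trans[OF edge_point_dist] mult_left_mono) simp_all
    also have "\<dots> < \<epsilon>" using \<epsilon> by simp
    finally have "dist (\<phi> (?e \<theta>) T) (?e \<theta>'') < \<epsilon>" unfolding \<theta>'(3) .
    moreover have "0 \<le> \<theta>''" "\<theta>'' \<le> 1" using \<theta>'(1) \<theta>0 \<epsilon> by (simp_all add: \<theta>''_def)
    ultimately have "?C (?e \<theta>) (?e \<theta>'')"
      unfolding chain_step_def using edge_point_in[OF p q \<theta>0 \<theta>(2)] edge_point_in[OF p q, of \<theta>'']
      by blast
    with \<theta>(3) have "?C\<^sup>*\<^sup>* (?e 0) (?e \<theta>'')" by (rule rtranclp.rtrancl_into_rtrancl)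
    moreover have "min 1 (real (Suc n) * (\<epsilon> / 4)) \<le> \<theta>''"
    proof -
      have "real (Suc n) * (\<epsilon> / 4) = real n * (\<epsilon> / 4) + \<epsilon> / 4" by (simp add: distrib_right)
      then show ?thesis using \<theta>(1) \<theta>'(1) \<epsilon> unfolding \<theta>''_def min_def by (simp split: if_splits)
    qed
    ultimately show ?case by (intro exI[of _ \<theta>'']) (simp add: \<theta>''_def)
  qed
  obtain n :: nat where "1 / (\<epsilon> / 4) < real n" using reals_Archimedean2 by blast
  then have "1 \<le> real n * (\<epsilon> / 4)" using \<epsilon> by (simp add: divide_less_eq)
  then have "min 1 (real n * (\<epsilon> / 4)) = 1" by simp
  with walk[of n] obtain \<theta> where \<theta>: "1 \<le> \<theta>" "\<theta> \<le> 1" "?C\<^sup>*\<^sup>* (?e 0) (?e \<theta>)" by (elim exE conjE) simp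
  have "\<theta> = 1" using \<theta>(1,2) by simp
  with \<theta>(3) have "?C\<^sup>*\<^sup>* (?e 0) (?e 1)" by (simp only:)
  moreover have "?e 0 = vertex p" by (simp add: edge_point_def vertex_def vec_eq_iff)
  moreover have "?e 1 = vertex q" using comp by (simp add: edge_point_def vertex_def vec_eq_iff comparable_def)
  ultimately show ?thesis by simp
qed

lemma reach_response_graph:
  fixes S :: "'n::finite \<Rightarrow> 's::finite set"
  assumes fl: "is_flow_of (replicator_field S u) (mixed_profiles S) \<phi>"
    and \<epsilon>: "0 < \<epsilon>" and T: "0 < T" and pq: "p \<rightarrow>\<^sup>*\<^bsub>response_graph S u\<^esub> q"
  shows "(chain_step (mixed_profiles S) \<phi> \<epsilon> T)\<^sup>*\<^sup>* (vertex p) (vertex q)"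
  using reachable_rtranclI[OF pq]
proof (induction rule: rtrancl_induct)
  case (step q r)
  then obtain i where "q \<in> profiles S" "r \<in> profiles S" "comparable i q r" "u q $ i \<le> u r $ i"
    by (auto simp: arcs_ends_conv response_graph_def)
  from rtranclp_trans[OF step.IH reach_arc[OF fl this \<epsilon> T]] show ?case .
qed simp

theorem corollary5p3:
  fixes S :: "'n::finite \<Rightarrow> 's::finite set"
    and u :: "('n \<Rightarrow> 's) \<Rightarrow> real ^ 'n"
    and \<phi> :: "real ^ 's ^ 'n \<Rightarrow> real \<Rightarrow> real ^ 's ^ 'n"
  assumes "\<And>i. S i \<noteq> {}"
    and "is_replicator_flow S u \<phi>"
    and "strongly_connected (response_graph S u)"
  shows "\<forall>x\<in>mixed_profiles S. chain_recurrent (mixed_profiles S) \<phi> x"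
proof
  fix x assume x: "x \<in> mixed_profiles S"
  let ?X = "mixed_profiles S"
  have fl: "is_flow_of (replicator_field S u) ?X \<phi>"
    using assms(2) by (simp add: is_replicator_flow_def)
  have "has_chain ?X \<phi> \<epsilon> T x x" if \<epsilon>: "0 < \<epsilon>" and T: "0 < T" for \<epsilon> T
  proof (rule has_chain_tranclp)
    let ?C = "chain_step ?X \<phi> \<epsilon> T"
    have y: "\<phi> x T \<in> ?X" using fl x by (simp add: is_flow_of_def)
    \<comment> \<open>One exact flow step makes the closed chain nonempty; all the pieces appended
      to it may have length 0.\<close>
    have first: "?C x (\<phi> x T)" using x y \<epsilon> by (simp add: chain_step_def)
    obtain p where p: "p \<in> profiles S" "?C\<^sup>*\<^sup>* (\<phi> x T) (vertex p)"
      using reach_vertex[OF fl y \<epsilon> T] by blast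
    obtain q where q: "q \<in> profiles S" "?C\<^sup>*\<^sup>* (vertex q) x"
      using reach_from_vertex[OF fl x \<epsilon> T] by blast
    have "p \<rightarrow>\<^sup>*\<^bsub>response_graph S u\<^esub> q"
      using assms(3) p(1) q(1) by (auto simp: strongly_connected_def response_graph_def)
    from reach_response_graph[OF fl \<epsilon> T this] q(2) have "?C\<^sup>*\<^sup>* (vertex p) x" by (rule rtranclp_trans)
    with p(2) have "?C\<^sup>*\<^sup>* (\<phi> x T) x" by (rule rtranclp_trans)
    with first show "?C\<^sup>+\<^sup>+ x x" by (rule rtranclp_into_tranclp2)
  qed
  then show "chain_recurrent ?X \<phi> x"
    by (simp add: chain_recurrent_def has_pseudo_orbit_def)
qed

end
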